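(* Let $d\ge1$ and suppose $u_0\in L^1(n)$ for some real $n\ge0$. If $u(t)=K_\nu(t)*u_0$ is the solution of the heat equation in $C^0([0,\infty),L^1(n))$ with initial condition $u_0$, then we can write $$u(x,t)=\sum_{|\alpha|\le\lfloor n\rfloor}\langle H_\alpha,u_0\rangle\,\partial_x^\alpha K_\nu(t)*\phi_0(x)+R(x,t),$$ where for any $0\le\mu\le n$ and $1\le p\le\infty$ there is a constant $C$, independent of $u_0$ and $t$, such that for all $t>0$ $$\|R(\cdot,t)\|_{\mathring L^p(\mu)}\le C\|u_0\|_{L^1(n)}(\nu t)^{-\frac d2(1-\frac1p)-\frac{n-\mu}2}.$$
   Context: $\nu>0$; $K_\nu(t)(x)=(4\pi\nu t)^{-d/2}e^{-|x|^2/(4\nu t)}$ is the heat kernel on $\mathbb{R}^d$. $\phi_0(x)=(4\pi)^{-d/2}e^{-|x|^2/4}$, and $H_\alpha(x)=\frac{2^{|\alpha|}}{\alpha!}e^{|x|^2/4}\partial_x^\alpha(e^{-|x|^2/4})$ is the $\alpha$-th Hermite polynomial. $\langle f,g\rangle=\int_{\mathbb{R}^d}f(x)g(x)\,dx$. $\|f\|_{\mathring L^p(\mu)}=\||x|^\mu f\|_{L^p(\mathbb{R}^d)}$ and $\|f\|_{L^1(n)}=\|(1+|x|)^nf\|_{L^1(\mathbb{R}^d)}$. *)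

theory Defs
  imports "HOL-Analysis.Analysis" "HOL-Probability.Essential_Supremum"
begin

text \<open>
  The space is \<open>real ^ 'd\<close>, of dimension \<open>CARD('d) \<ge> 1\<close>, and multi-indices are functions
  \<open>'d \<Rightarrow> nat\<close>. Integrals are taken with respect to \<open>lebesgue\<close>, so that functions need only be
  Lebesgue measurable.
\<close>

definition mi_order :: "('d::finite \<Rightarrow> nat) \<Rightarrow> nat" where
  "mi_order \<alpha> = (\<Sum>i\<in>UNIV. \<alpha> i)"

definition mi_fact :: "('d::finite \<Rightarrow> nat) \<Rightarrow> real" where
  "mi_fact \<alpha> = (\<Prod>i\<in>UNIV. fact (\<alpha> i))"

text \<open>A sum over an infinite set would be 0 by convention; this is not the case here.\<close>

lemma finite_mi_order_le: "finite {\<alpha> :: 'd::finite \<Rightarrow> nat. mi_order \<alpha> \<le> N}"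
proof (rule finite_subset)
  show "{\<alpha> :: 'd \<Rightarrow> nat. mi_order \<alpha> \<le> N} \<subseteq> (\<Pi>\<^sub>E i\<in>UNIV. {..N})"
  proof
    fix \<alpha> :: "'d \<Rightarrow> nat" assume "\<alpha> \<in> {\<alpha>. mi_order \<alpha> \<le> N}"
    then have "\<alpha> i \<le> N" for i
      using member_le_sum[of i UNIV \<alpha>] by (auto simp: mi_order_def)
    then show "\<alpha> \<in> (\<Pi>\<^sub>E i\<in>UNIV. {..N})" by auto
  qed
  show "finite (\<Pi>\<^sub>E i\<in>(UNIV :: 'd set). {..N})"
    by (rule finite_PiE) auto
qed

definition partial_deriv :: "'d \<Rightarrow> (real ^ 'd \<Rightarrow> real) \<Rightarrow> real ^ 'd::finite \<Rightarrow> real" where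
  "partial_deriv i f x = deriv (\<lambda>s. f (x + s *\<^sub>R axis i 1)) 0"

text \<open>
  The iterated partial derivatives are taken in the order of an unspecified enumeration of the
  coordinates. The order is irrelevant, as \<open>mi_deriv\<close> is only applied to smooth functions.
\<close>

definition coord_list :: "'d::finite list" where
  "coord_list = (SOME xs. distinct xs \<and> set xs = UNIV)"

lemma coord_list: "distinct (coord_list :: 'd::finite list)" "set (coord_list :: 'd list) = UNIV"
proof -
  have "\<exists>xs :: 'd list. distinct xs \<and> set xs = UNIV"
    using finite_distinct_list[of "UNIV :: 'd set"] by auto
  then have "distinct (coord_list :: 'd list) \<and> set (coord_list :: 'd list) = UNIV"
    unfolding coord_list_def by (rule someI_ex)
  then show "distinct (coord_list :: 'd list)" "set (coord_list :: 'd list) = UNIV"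
    by auto
qed

definition mi_deriv :: "('d::finite \<Rightarrow> nat) \<Rightarrow> (real ^ 'd \<Rightarrow> real) \<Rightarrow> real ^ 'd \<Rightarrow> real" where
  "mi_deriv \<alpha> f = foldr (\<lambda>i g. (partial_deriv i ^^ \<alpha> i) g) coord_list f"

definition conv :: "(real ^ 'd \<Rightarrow> real) \<Rightarrow> (real ^ 'd \<Rightarrow> real) \<Rightarrow> real ^ 'd::finite \<Rightarrow> real" where
  "conv f g x = (LINT y|lebesgue. f (x - y) * g y)"

definition pairing :: "(real ^ 'd::finite \<Rightarrow> real) \<Rightarrow> (real ^ 'd \<Rightarrow> real) \<Rightarrow> real" where
  "pairing f g = (LINT x|lebesgue. f x * g x)"

definition heat_kernel :: "real \<Rightarrow> real \<Rightarrow> real ^ 'd::finite \<Rightarrow> real" where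
  "heat_kernel \<nu> t x =
     (4 * pi * \<nu> * t) powr (- real CARD('d) / 2) * exp (- (norm x)\<^sup>2 / (4 * \<nu> * t))"

definition phi0 :: "real ^ 'd::finite \<Rightarrow> real" where
  "phi0 x = (4 * pi) powr (- real CARD('d) / 2) * exp (- (norm x)\<^sup>2 / 4)"

definition hermite :: "('d::finite \<Rightarrow> nat) \<Rightarrow> real ^ 'd \<Rightarrow> real" where
  "hermite \<alpha> x = 2 ^ mi_order \<alpha> / mi_fact \<alpha> * exp ((norm x)\<^sup>2 / 4)
     * mi_deriv \<alpha> (\<lambda>y. exp (- (norm y)\<^sup>2 / 4)) x"

text \<open>
  The norm of \<open>L\<^sup>p\<close>, with values in \<open>[0, \<infinity>]\<close>. As for \<^const>\<open>esssup\<close>, it is infinite on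
  non-measurable functions, so that a finite norm means membership in \<open>L\<^sup>p\<close>. For finite
  \<open>p\<close> the \<open>p\<close>-th root is taken in \<open>real\<close>, there being no \<open>powr\<close> on \<open>ennreal\<close>.
\<close>

definition Lp_norm :: "ennreal \<Rightarrow> (real ^ 'd::finite \<Rightarrow> real) \<Rightarrow> ennreal" where
  "Lp_norm p f =
     (if f \<notin> borel_measurable lebesgue then \<infinity>
      else if p = \<infinity> then esssup lebesgue (\<lambda>x. ennreal \<bar>f x\<bar>)
      else let I = (\<integral>\<^sup>+x. ennreal (\<bar>f x\<bar> powr enn2real p) \<partial>lebesgue) in
        if I = \<infinity> then \<infinity> else ennreal (enn2real I powr (1 / enn2real p)))"

text \<open>
  For \<open>\<mu> = 0\<close> the convention \<open>0 powr 0 = 0\<close> changes the weight at the origin only,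
  which does not affect the norm.
\<close>

definition hom_Lp_norm :: "ennreal \<Rightarrow> real \<Rightarrow> (real ^ 'd::finite \<Rightarrow> real) \<Rightarrow> ennreal" where
  "hom_Lp_norm p \<mu> f = Lp_norm p (\<lambda>x. norm x powr \<mu> * f x)"

definition L1_norm :: "real \<Rightarrow> (real ^ 'd::finite \<Rightarrow> real) \<Rightarrow> ennreal" where
  "L1_norm n f = Lp_norm 1 (\<lambda>x. (1 + norm x) powr n * f x)"

definition L1_space :: "real \<Rightarrow> (real ^ 'd::finite \<Rightarrow> real) set" where
  "L1_space n = {f. L1_norm n f < \<infinity>}"

end

theory Submission
  imports Defs "HOL-Probability.Distributions" "HOL-Complex_Analysis.Complex_Analysis"
    "HOL-Real_Asymp.Real_Asymp"
begin

text \<open>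
  Write \<open>s = \<nu> t\<close>, \<open>\<sigma> = s + 1\<close> and let \<open>G(x, s)\<close> be the heat kernel at time \<open>s\<close>. The derivatives of
  \<open>K\<^sub>\<nu>(t) * \<phi>\<^sub>0\<close> are those of \<open>G(\<cdot>, \<sigma>)\<close>, and the products \<open>H\<^sub>\<alpha>(y) \<partial>\<^sup>\<alpha> G(x, \<sigma>)\<close> of order \<open>k\<close> add up to
  the coefficient of \<open>\<tau>\<^sup>k\<close> in the Taylor series of \<open>\<tau> \<mapsto> G(x - \<tau> y, \<sigma> - \<tau>\<^sup>2)\<close> (Mehler's formula), whose
  value at \<open>\<tau> = 1\<close> is \<open>G(x - y, s)\<close>. So \<open>R\<close> has the Taylor remainder as integral kernel.
  In each coordinate this function of \<open>\<tau>\<close> is holomorphic with a Gaussian bound on a disc of radius comparable to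
  \<open>\<surd>\<sigma> / (1 + |y|)\<close>, and Cauchy's inequality bounds the terms of order \<open>k\<close> by
  \<open>\<rho>\<^sup>k \<sigma>\<^bsup>-d/2\<^esup> exp (-|x|\<^sup>2 / (20 \<sigma>))\<close> with \<open>\<rho> = 2 (1 + |y|) / \<surd>\<sigma>\<close>. If \<open>\<rho> \<le> 1/2\<close> the tail of the series is
  summed, otherwise every term is estimated separately; in both cases \<open>|x|\<^sup>\<mu>\<close> times the kernel is at
  most a multiple of \<open>\<rho>\<^sup>n \<sigma>\<^bsup>\<mu>/2\<^esup>\<close> times Gaussians. This gives the estimates for \<open>p = 1\<close> and \<open>p = \<infinity>\<close>, and the others follow by interpolation.
\<close>

section \<open>One-dimensional heat kernel and Hermite polynomials\<close>

text \<open>\<open>heat_deriv s k\<close> is the \<open>k\<close>-th derivative of the one-dimensional heat kernel at time \<open>s\<close>.\<close>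

fun heat_deriv :: "real \<Rightarrow> nat \<Rightarrow> real \<Rightarrow> real" where
  "heat_deriv s 0 x = normal_density 0 (sqrt (2 * s)) x"
| "heat_deriv s (Suc 0) x = - (x * heat_deriv s 0 x) / (2 * s)"
| "heat_deriv s (Suc (Suc k)) x = - (x * heat_deriv s (Suc k) x + real (Suc k) * heat_deriv s k x) / (2 * s)"

text \<open>Differentiating \<open>2 * s * g' = - x * g\<close> for the Gaussian \<open>g\<close>
  repeatedly gives this three-term recurrence. The truncated \<open>k - 1\<close> at
  \<open>k = 0\<close> is harmless, because its factor \<open>real k\<close> vanishes.\<close>

lemma heat_deriv_Suc: "heat_deriv s (Suc k) x = - (x * heat_deriv s k x + real k * heat_deriv s (k - 1) x) / (2 * s)"
  by (cases k) auto

lemma heat_deriv_0: "s > 0 \<Longrightarrow> heat_deriv s 0 x = exp (- x\<^sup>2 / (4 * s)) / sqrt (4 * pi * s)"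
  by (simp add: normal_density_def)

lemma heat_deriv_0_fun: "s > 0 \<Longrightarrow> heat_deriv s 0 = (\<lambda>x. exp (- x\<^sup>2 / (4 * s)) / sqrt (4 * pi * s))"
  by (rule ext) (rule heat_deriv_0)

lemma heat_deriv_0_pos: "s > 0 \<Longrightarrow> heat_deriv s 0 x > 0"
  by (simp add: normal_density_pos)

declare heat_deriv.simps [simp del]

text \<open>Strong induction: differentiating the recurrence for order \<open>Suc j\<close> produces
  one extra copy of \<open>heat_deriv s j x\<close>, which turns the coefficient \<open>j\<close>
  into \<open>j + 1\<close> and so yields the recurrence one order higher.\<close>

lemma has_real_derivative_heat_deriv:
  assumes s: "s > 0"
  shows "(heat_deriv s k has_real_derivative heat_deriv s (Suc k) x) (at x)"
proof (induction k rule: less_induct)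
  case (less k)
  show ?case
  proof (cases k)
    case 0
    have "((\<lambda>x. exp (- x\<^sup>2 / (4 * s)) / sqrt (4 * pi * s)) has_real_derivative heat_deriv s 1 x) (at x)"
      using s by (auto intro!: derivative_eq_intros simp: heat_deriv_Suc heat_deriv_0 field_simps)
    with 0 s show ?thesis by (simp add: heat_deriv_0_fun)
  next
    case (Suc j)
    have d: "(heat_deriv s j has_real_derivative heat_deriv s k x) (at x)" using less.IH[of j] Suc by simp
    have d': "((\<lambda>x. real j * heat_deriv s (j - 1) x) has_real_derivative real j * heat_deriv s j x) (at x)"
    proof (cases j)
      case (Suc i)
      then show ?thesis using less.IH[of i] \<open>k = Suc j\<close>
        by (auto intro!: derivative_eq_intros)
    qed simp
    have "((\<lambda>x. - (x * heat_deriv s j x + real j * heat_deriv s (j - 1) x) / (2 * s)) has_real_derivative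
        - ((1 * heat_deriv s j x + heat_deriv s k x * x) + real j * heat_deriv s j x) / (2 * s)) (at x)"
      using DERIV_cdivide[OF DERIV_minus[OF DERIV_add[OF DERIV_mult[OF DERIV_ident d] d']], of "2 * s"] by simp
    then show ?thesis using s Suc
      by (simp add: heat_deriv_Suc[abs_def] heat_deriv_Suc[of s "Suc j"] algebra_simps)
  qed
qed

lemma continuous_on_heat_deriv [continuous_intros]:
  assumes "s > 0" "continuous_on A f"
  shows "continuous_on A (\<lambda>x. heat_deriv s k (f x))"
proof -
  have "continuous_on UNIV (heat_deriv s k)"
    using has_real_derivative_heat_deriv[OF assms(1)] by (meson DERIV_continuous continuous_at_imp_continuous_on)
  then show ?thesis using continuous_on_compose2[OF _ assms(2)] by blast
qed

lemma borel_measurable_heat_deriv [measurable]: "s > 0 \<Longrightarrow> heat_deriv s k \<in> borel_measurable borel"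
  by (intro borel_measurable_continuous_onI continuous_intros)

text \<open>The recurrence raises the degree of the polynomial factor by at most one. The Gaussian
  is kept as an explicit factor so that \<open>hermite1_bound\<close> can divide by it.\<close>

lemma heat_deriv_poly_bound:
  assumes s: "s > 0"
  shows "\<exists>C\<ge>0. \<forall>x. \<bar>heat_deriv s k x\<bar> \<le> C * (1 + \<bar>x\<bar>) ^ k * heat_deriv s 0 x"
proof (induction k rule: less_induct)
  case (less k)
  show ?case
  proof (cases k)
    case 0
    then show ?thesis using heat_deriv_0_pos[OF s] by (intro exI[of _ 1]) (simp add: less_imp_le)
  next
    case (Suc j)
    obtain C where C: "C \<ge> 0" "\<And>x. \<bar>heat_deriv s j x\<bar> \<le> C * (1 + \<bar>x\<bar>) ^ j * heat_deriv s 0 x"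
      using less.IH[of j] Suc by auto
    obtain D where D: "D \<ge> 0" "\<And>x. real j * \<bar>heat_deriv s (j - 1) x\<bar> \<le> D * (1 + \<bar>x\<bar>) ^ j * heat_deriv s 0 x"
    proof (cases j)
      case 0
      then show ?thesis using that[of 0] heat_deriv_0_pos[OF s] by simp
    next
      case (Suc i)
      obtain D where D: "D \<ge> 0" "\<And>x. \<bar>heat_deriv s i x\<bar> \<le> D * (1 + \<bar>x\<bar>) ^ i * heat_deriv s 0 x"
        using less.IH[of i] Suc \<open>k = Suc j\<close> by auto
      have "real j * \<bar>heat_deriv s i x\<bar> \<le> real j * D * (1 + \<bar>x\<bar>) ^ j * heat_deriv s 0 x" for x
      proof -
        have "D * (1 + \<bar>x\<bar>) ^ i * heat_deriv s 0 x \<le> D * (1 + \<bar>x\<bar>) ^ j * heat_deriv s 0 x"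
          using D(1) heat_deriv_0_pos[OF s, of x] Suc by (intro mult_mono power_increasing) auto
        with D(2)[of x] have "\<bar>heat_deriv s i x\<bar> \<le> D * (1 + \<bar>x\<bar>) ^ j * heat_deriv s 0 x" by linarith
        then show ?thesis using mult_left_mono[of _ _ "real j"] by (simp add: mult.assoc)
      qed
      then show ?thesis using that[of "real j * D"] D(1) Suc by simp
    qed
    have "\<bar>heat_deriv s k x\<bar> \<le> (C + D) / (2 * s) * (1 + \<bar>x\<bar>) ^ k * heat_deriv s 0 x" for x
    proof -
      have "\<bar>x * heat_deriv s j x\<bar> \<le> (1 + \<bar>x\<bar>) * (C * (1 + \<bar>x\<bar>) ^ j * heat_deriv s 0 x)"
        unfolding abs_mult using C(2)[of x] by (intro mult_mono) auto
      moreover have "D * (1 + \<bar>x\<bar>) ^ j * heat_deriv s 0 x \<le> D * (1 + \<bar>x\<bar>) ^ k * heat_deriv s 0 x"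
        using D(1) heat_deriv_0_pos[OF s, of x] Suc by (intro mult_mono power_increasing) auto
      ultimately have "\<bar>x * heat_deriv s j x + real j * heat_deriv s (j - 1) x\<bar> \<le> (C + D) * (1 + \<bar>x\<bar>) ^ k * heat_deriv s 0 x"
        using D(2)[of x] abs_triangle_ineq[of "x * heat_deriv s j x" "real j * heat_deriv s (j - 1) x"] Suc
        by (simp add: algebra_simps abs_mult)
      then show ?thesis unfolding Suc using s Suc
        by (simp add: heat_deriv_Suc abs_mult divide_right_mono)
    qed
    then show ?thesis using C(1) D(1) s by (intro exI[of _ "(C + D) / (2 * s)"]) auto
  qed
qed

text \<open>From \<open>1 + \<bar>x\<bar> \<le> exp \<bar>x\<bar>\<close> the power is at most
  \<open>exp (k * \<bar>x\<bar>)\<close>, and completing the square against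
  \<open>x\<^sup>2 / (4 * s)\<close> leaves a constant.\<close>

lemma power_mult_gauss_bound:
  assumes s: "s > 0"
  shows "(1 + \<bar>x\<bar>) ^ k * exp (- x\<^sup>2 / (4 * s)) \<le> exp (s * (real k)\<^sup>2)"
proof -
  have "(1 + \<bar>x\<bar>) ^ k \<le> exp (\<bar>x\<bar>) ^ k"
    by (intro power_mono) auto
  also have "\<dots> = exp (real k * \<bar>x\<bar>)" by (simp add: exp_of_nat_mult)
  also have "real k * \<bar>x\<bar> \<le> s * (real k)\<^sup>2 + x\<^sup>2 / (4 * s)"
  proof -
    have "0 \<le> (2 * s * real k - \<bar>x\<bar>)\<^sup>2 / (4 * s)" using s by simp
    also have "\<dots> = s * (real k)\<^sup>2 + x\<^sup>2 / (4 * s) - real k * \<bar>x\<bar>"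
      using s by (simp add: power2_diff field_simps power2_eq_square)
    finally show ?thesis by simp
  qed
  finally have "(1 + \<bar>x\<bar>) ^ k \<le> exp (s * (real k)\<^sup>2 + x\<^sup>2 / (4 * s))" by simp
  then show ?thesis by (simp add: exp_add exp_minus field_simps)
qed

lemma heat_deriv_bounded:
  assumes s: "s > 0"
  shows "\<exists>C\<ge>0. \<forall>x. \<bar>heat_deriv s k x\<bar> \<le> C"
proof -
  obtain C where C: "C \<ge> 0" "\<And>x. \<bar>heat_deriv s k x\<bar> \<le> C * (1 + \<bar>x\<bar>) ^ k * heat_deriv s 0 x"
    using heat_deriv_poly_bound[OF s] by blast
  let ?D = "C * exp (s * (real k)\<^sup>2) / sqrt (4 * pi * s)"
  have "\<bar>heat_deriv s k x\<bar> \<le> ?D" for x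
  proof -
    have "\<bar>heat_deriv s k x\<bar> \<le> C * ((1 + \<bar>x\<bar>) ^ k * exp (- x\<^sup>2 / (4 * s))) / sqrt (4 * pi * s)"
      using C(2)[of x] s by (simp add: heat_deriv_0 mult.assoc)
    also have "\<dots> \<le> ?D"
      using power_mult_gauss_bound[OF s, of x k] C(1) s
      by (intro divide_right_mono mult_left_mono) auto
    finally show ?thesis .
  qed
  then show ?thesis using C(1) s by (intro exI[of _ ?D]) auto
qed

section \<open>Convolution of the one-dimensional heat kernel with the Gaussian at time 1\<close>

lemma integrable_heat_deriv_mult:
  assumes s: "s > 0" and r: "r > 0"
  shows "integrable lborel (\<lambda>z. heat_deriv s k (x - z) * heat_deriv r 0 z)"
    and "integrable lborel (\<lambda>z. z * (heat_deriv s k (x - z) * heat_deriv r 0 z))"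
proof -
  note [measurable] = borel_measurable_heat_deriv[OF s] borel_measurable_heat_deriv[OF r]
  obtain C where C: "C \<ge> 0" "\<And>x. \<bar>heat_deriv s k x\<bar> \<le> C" using heat_deriv_bounded[OF s] by blast
  have 1: "integrable lborel (\<lambda>z. C * heat_deriv r 0 z)"
    using r by (simp add: heat_deriv.simps)
  show "integrable lborel (\<lambda>z. heat_deriv s k (x - z) * heat_deriv r 0 z)"
    using C heat_deriv_0_pos[OF r]
    by (intro Bochner_Integration.integrable_bound[OF 1])
      (auto simp: abs_mult less_imp_le intro!: mult_mono AE_I2)
  have 2: "integrable lborel (\<lambda>z. \<bar>z\<bar> * (C * heat_deriv r 0 z))"
    using integrable_normal_moment_abs[of "sqrt (2 * r)" 0 1] r by (simp add: heat_deriv.simps ac_simps)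
  show "integrable lborel (\<lambda>z. z * (heat_deriv s k (x - z) * heat_deriv r 0 z))"
    using C heat_deriv_0_pos[OF r]
    by (intro Bochner_Integration.integrable_bound[OF 2])
      (auto simp: abs_mult less_imp_le intro!: mult_mono AE_I2)
qed

text \<open>The fundamental theorem of calculus on the whole line. Applied to the derivative of a
  product, it is integration by parts without boundary terms.\<close>

lemma integral_total_derivative_zero:
  fixes F f :: "real \<Rightarrow> real"
  assumes F: "\<And>x. (F has_real_derivative f x) (at x)"
    and cont: "continuous_on UNIV f" and int: "integrable lborel f"
    and lim: "(F \<longlongrightarrow> 0) at_top" "(F \<longlongrightarrow> 0) at_bot"
  shows "(LINT x|lborel. f x) = 0"
proof -
  have "(LBINT x=-\<infinity>..\<infinity>. f x) = 0 - 0"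
  proof (rule interval_integral_FTC_integrable)
    show "((F \<circ> real_of_ereal) \<longlongrightarrow> 0) (at_right (- \<infinity>))"
      using lim(2) by (simp add: ereal_tendsto_simps)
    show "((F \<circ> real_of_ereal) \<longlongrightarrow> 0) (at_left \<infinity>)"
      using lim(1) by (simp add: ereal_tendsto_simps)
    show "set_integrable lborel (einterval (- \<infinity>) \<infinity>) f"
      using int by (simp add: set_integrable_def)
  qed (use F cont in \<open>auto simp: has_real_derivative_iff_has_vector_derivative continuous_on_eq_continuous_at\<close>)
  then show ?thesis
    by (simp add: interval_lebesgue_integral_def set_lebesgue_integral_def)
qed

lemma heat_deriv_0_tendsto:
  assumes s: "s > 0"
  shows "(heat_deriv s 0 \<longlongrightarrow> 0) at_top" "(heat_deriv s 0 \<longlongrightarrow> 0) at_bot"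
proof -
  have "((\<lambda>x. exp (- x\<^sup>2 / (4 * s)) / sqrt (4 * pi * s)) \<longlongrightarrow> 0) at_top"
    using s by real_asymp
  then show "(heat_deriv s 0 \<longlongrightarrow> 0) at_top" using s by (simp add: heat_deriv_0_fun)
  have "((\<lambda>x. exp (- x\<^sup>2 / (4 * s)) / sqrt (4 * pi * s)) \<longlongrightarrow> 0) at_bot"
    using s by real_asymp
  then show "(heat_deriv s 0 \<longlongrightarrow> 0) at_bot" using s by (simp add: heat_deriv_0_fun)
qed

text \<open>Semigroup property for all derivatives, obtained without differentiating under the
  integral: as functions of \<open>k\<close> the convolutions obey the recurrence that characterizes
  \<open>heat_deriv (s + 1)\<close>, and for \<open>k = 0\<close> they are convolutions of two
  centred normal densities.\<close>

lemma heat_deriv_convolution: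
  assumes s: "s > 0"
  shows "(LINT z|lborel. heat_deriv s k (x - z) * heat_deriv 1 0 z) = heat_deriv (s + 1) k x"
proof -
  note [measurable] = borel_measurable_heat_deriv[OF s] borel_measurable_heat_deriv[OF zero_less_one]
  define I where "I k = (LINT z|lborel. heat_deriv s k (x - z) * heat_deriv 1 0 z)" for k
  define J where "J k = (LINT z|lborel. z * (heat_deriv s k (x - z) * heat_deriv 1 0 z))" for k
  have int: "integrable lborel (\<lambda>z. heat_deriv s k (x - z) * heat_deriv 1 0 z)"
     "integrable lborel (\<lambda>z. z * (heat_deriv s k (x - z) * heat_deriv 1 0 z))" for k
    using integrable_heat_deriv_mult[OF s zero_less_one] by blast+
  \<comment> \<open>The derivative of \<open>heat_deriv 1 0\<close> is \<open>- z / 2\<close> times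
    itself, so integrating the derivative of the product \<open>F\<close> over the line relates the
    convolution of order \<open>Suc k\<close> to the first moment \<open>J k\<close>.\<close>
  have IJ: "2 * I (Suc k) = - J k" for k
  proof -
    obtain C where C: "C \<ge> 0" "\<And>x. \<bar>heat_deriv s k x\<bar> \<le> C" using heat_deriv_bounded[OF s] by blast
    define F where "F z = heat_deriv s k (x - z) * heat_deriv 1 0 z" for z
    define f where "f z = - (heat_deriv s (Suc k) (x - z) * heat_deriv 1 0 z) - (z * (heat_deriv s k (x - z) * heat_deriv 1 0 z)) / 2" for z
    have "(F has_real_derivative f z) (at z)" for z
    proof -
      have "((\<lambda>z. heat_deriv s k (x - z)) has_real_derivative heat_deriv s (Suc k) (x - z) * (- 1)) (at z)"
        by (rule DERIV_chain2[OF has_real_derivative_heat_deriv[OF s]])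
          (auto intro!: derivative_eq_intros)
      then show ?thesis unfolding F_def f_def
        by (rule derivative_eq_intros)
          (auto intro!: derivative_eq_intros has_real_derivative_heat_deriv simp: heat_deriv_Suc[of 1 0] field_simps)
    qed
    moreover have "continuous_on UNIV f" unfolding f_def using s by (intro continuous_intros) auto
    moreover have "integrable lborel f" unfolding f_def using int by auto
    moreover have "(F \<longlongrightarrow> 0) at_top" "(F \<longlongrightarrow> 0) at_bot"
    proof -
      have b: "\<bar>F z\<bar> \<le> C * heat_deriv 1 0 z" for z unfolding F_def abs_mult
        using C heat_deriv_0_pos[of 1] by (intro mult_mono) (auto simp: less_imp_le)
      have "((\<lambda>z. C * heat_deriv 1 0 z) \<longlongrightarrow> 0) at_top" "((\<lambda>z. C * heat_deriv 1 0 z) \<longlongrightarrow> 0) at_bot"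
        using heat_deriv_0_tendsto[OF zero_less_one] by (auto intro: tendsto_mult_right_zero)
      then show "(F \<longlongrightarrow> 0) at_top" "(F \<longlongrightarrow> 0) at_bot"
        using b by (auto intro!: Lim_null_comparison[of F "\<lambda>z. C * heat_deriv 1 0 z"] always_eventually)
    qed
    ultimately have "(LINT z|lborel. f z) = 0" by (rule integral_total_derivative_zero)
    then show ?thesis unfolding f_def I_def J_def using int[of k] int[of "Suc k"] by simp
  qed
  \<comment> \<open>The recurrence at \<open>x - z\<close> gives
    \<open>2 * s * I (Suc k) = J k - x * I k - k * I (k - 1)\<close>. Adding \<open>IJ\<close>
    cancels \<open>J k\<close> and turns \<open>s\<close> into \<open>s + 1\<close>.\<close>
  have rec: "I (Suc k) = - (x * I k + real k * I (k - 1)) / (2 * (s + 1))" for k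
  proof -
    have "2 * s * I (Suc k) = (LINT z|lborel. z * (heat_deriv s k (x - z) * heat_deriv 1 0 z)
       - x * (heat_deriv s k (x - z) * heat_deriv 1 0 z) - real k * (heat_deriv s (k - 1) (x - z) * heat_deriv 1 0 z))"
      unfolding I_def Bochner_Integration.integral_mult_right_zero[symmetric]
      by (intro Bochner_Integration.integral_cong refl) (use s in \<open>simp add: heat_deriv_Suc field_simps\<close>)
    also have "\<dots> = J k - x * I k - real k * I (k - 1)"
      unfolding I_def J_def using int[of k] int[of "k - 1"] by simp
    finally show ?thesis using IJ[of k] s by (simp add: field_simps)
  qed
  have "I 0 = heat_deriv (s + 1) 0 x"
  proof -
    have "(\<integral>\<^sup>+z. ennreal (heat_deriv s 0 (x - z) * heat_deriv 1 0 z) \<partial>lborel) = ennreal (heat_deriv (s + 1) 0 x)"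
      using fun_cong[OF conv_normal_density_zero_mean[of "sqrt (2 * s)" "sqrt 2"], of x] s
      by (simp add: heat_deriv.simps algebra_simps)
    then show ?thesis unfolding I_def
      using heat_deriv_0_pos[of "s + 1" x] heat_deriv_0_pos[OF s] heat_deriv_0_pos[of 1] s
      by (intro integral_eq_nn_integral[THEN trans]) (auto simp: less_imp_le)
  qed
  then have "I k = heat_deriv (s + 1) k x"
  proof (induction k rule: less_induct)
    case (less k)
    then show ?case by (cases k) (auto simp: rec heat_deriv_Suc)
  qed
  then show ?thesis by (simp add: I_def)
qed

section \<open>Hermite polynomials in one variable\<close>

definition hermite1 :: "nat \<Rightarrow> real \<Rightarrow> real" where
  "hermite1 k y = 2 ^ k / fact k * heat_deriv 1 k y / heat_deriv 1 0 y"

lemma hermite1_0: "hermite1 0 y = 1"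
  using heat_deriv_0_pos[of 1 y] by (simp add: hermite1_def)

text \<open>The recurrence of \<open>heat_deriv 1\<close> after normalization; equivalently, the
  generating function \<open>exp (- y * X - X\<^sup>2)\<close> has logarithmic derivative
  \<open>- y - 2 * X\<close>. Here no factor \<open>k\<close> removes the term with
  \<open>k - 1\<close> at \<open>k = 0\<close>, hence the case distinction.\<close>

lemma hermite1_Suc: "real (Suc k) * hermite1 (Suc k) y = - y * hermite1 k y - 2 * (if k = 0 then 0 else hermite1 (k - 1) y)"
proof (cases k)
  case 0
  then show ?thesis using heat_deriv_0_pos[of 1 y] by (simp add: hermite1_def heat_deriv_Suc field_simps)
next
  case (Suc j)
  have "hermite1 (Suc (Suc j)) y = 2 * 2 ^ Suc j / (real (Suc (Suc j)) * fact (Suc j)) * (- (y * heat_deriv 1 (Suc j) y + real (Suc j) * heat_deriv 1 j y) / 2) / heat_deriv 1 0 y"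
    by (simp add: hermite1_def heat_deriv_Suc[of 1 "Suc j"])
  then have "real (Suc (Suc j)) * hermite1 (Suc (Suc j)) y = 2 ^ Suc j / fact (Suc j) * (- (y * heat_deriv 1 (Suc j) y + real (Suc j) * heat_deriv 1 j y)) / heat_deriv 1 0 y"
    by (simp del: fact_Suc of_nat_Suc power_Suc)
  also have "\<dots> = - y * hermite1 (Suc j) y - 2 * hermite1 j y"
    using heat_deriv_0_pos[of 1 y] by (simp add: hermite1_def field_simps del: of_nat_Suc)
  finally show ?thesis by (simp add: Suc)
qed

lemma hermite1_bound: "\<exists>C\<ge>0. \<forall>y. \<bar>hermite1 k y\<bar> \<le> C * (1 + \<bar>y\<bar>) ^ k"
proof -
  obtain C where C: "C \<ge> 0" "\<And>x. \<bar>heat_deriv 1 k x\<bar> \<le> C * (1 + \<bar>x\<bar>) ^ k * heat_deriv 1 0 x"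
    using heat_deriv_poly_bound[OF zero_less_one] by blast
  have "\<bar>hermite1 k y\<bar> \<le> (2 ^ k / fact k * C) * (1 + \<bar>y\<bar>) ^ k" for y
  proof -
    have "\<bar>heat_deriv 1 k y\<bar> / heat_deriv 1 0 y \<le> C * (1 + \<bar>y\<bar>) ^ k"
      using C(2)[of y] heat_deriv_0_pos[of 1 y] by (simp add: field_simps)
    then have "2 ^ k / fact k * (\<bar>heat_deriv 1 k y\<bar> / heat_deriv 1 0 y) \<le> 2 ^ k / fact k * (C * (1 + \<bar>y\<bar>) ^ k)"
      by (intro mult_left_mono) auto
    then show ?thesis using heat_deriv_0_pos[of 1 y] by (simp add: hermite1_def abs_mult)
  qed
  then show ?thesis using C(1) by (intro exI[of _ "2 ^ k / fact k * C"]) auto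
qed

lemma borel_measurable_hermite1 [measurable]: "hermite1 k \<in> borel_measurable borel"
proof -
  note [measurable] = borel_measurable_heat_deriv[OF zero_less_one]
  show ?thesis unfolding hermite1_def[abs_def] by measurable
qed

section \<open>Mehler's formula\<close>

text \<open>For \<open>norm \<tau> < sqrt \<sigma>\<close> the principal root is taken at a point of
  the right half-plane, away from its branch cut. The function is therefore holomorphic on a disc
  that contains 1 when \<open>\<sigma> = s + 1\<close> with \<open>s > 0\<close>.\<close>

definition mehler :: "real \<Rightarrow> real \<Rightarrow> real \<Rightarrow> complex \<Rightarrow> complex" where
  "mehler \<sigma> x y \<tau> = exp (- (of_real x - \<tau> * of_real y)\<^sup>2 / (4 * (of_real \<sigma> - \<tau>\<^sup>2)))
     / csqrt (of_real (4 * pi) * (of_real \<sigma> - \<tau>\<^sup>2))"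

lemma Re_sigma_minus:
  assumes "norm \<tau> < sqrt \<sigma>"
  shows "Re (of_real \<sigma> - \<tau>\<^sup>2) > 0"
proof -
  have "\<sigma> > 0" using assms norm_ge_zero[of \<tau>] by (smt (verit) real_sqrt_gt_0_iff)
  have "Re (\<tau>\<^sup>2) \<le> norm (\<tau>\<^sup>2)" by (rule complex_Re_le_cmod)
  also have "\<dots> = (norm \<tau>)\<^sup>2" by (simp add: norm_power)
  also have "\<dots> < (sqrt \<sigma>)\<^sup>2" using assms by (intro power_strict_mono) auto
  finally show ?thesis using \<open>\<sigma> > 0\<close> by simp
qed

lemma mehler_has_field_derivative:
  assumes "norm \<tau> < sqrt \<sigma>"
  shows "(mehler \<sigma> x y has_field_derivative
     (\<tau> / (of_real \<sigma> - \<tau>\<^sup>2) - (\<tau> * of_real x - of_real \<sigma> * of_real y) * (of_real x - \<tau> * of_real y)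
        / (2 * (of_real \<sigma> - \<tau>\<^sup>2)\<^sup>2)) * mehler \<sigma> x y \<tau>) (at \<tau>)"
proof -
  define q where "q = complex_of_real \<sigma> - \<tau>\<^sup>2"
  define v where "v = complex_of_real x - \<tau> * of_real y"
  have Re: "Re q > 0" using Re_sigma_minus[OF assms] by (simp add: q_def)
  then have q0: "q \<noteq> 0" by auto
  have "Re (of_real (4 * pi) * q) > 0" using Re by simp
  then have nr: "of_real (4 * pi) * q \<notin> \<real>\<^sub>\<le>\<^sub>0" using complex_nonpos_Reals_iff by auto
  define c where "c = csqrt (of_real (4 * pi) * q)"
  have c2: "c * c = of_real (4 * pi) * q" unfolding c_def by (metis power2_csqrt power2_eq_square)
  have c0: "c \<noteq> 0" using c2 q0 by auto
  have dq: "((\<lambda>\<tau>. of_real \<sigma> - \<tau>\<^sup>2) has_field_derivative - (2 * \<tau>)) (at \<tau>)"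
    by (auto intro!: derivative_eq_intros)
  have dv: "((\<lambda>\<tau>. of_real x - \<tau> * of_real y) has_field_derivative - of_real y) (at \<tau>)"
    by (auto intro!: derivative_eq_intros)
  have dw: "((\<lambda>\<tau>. - (of_real x - \<tau> * of_real y)\<^sup>2 / (4 * (of_real \<sigma> - \<tau>\<^sup>2))) has_field_derivative
      (of_real y * v / (2 * q) - \<tau> * v\<^sup>2 / (2 * q\<^sup>2))) (at \<tau>)"
  proof -
    have "((\<lambda>\<tau>. - (of_real x - \<tau> * of_real y)\<^sup>2) has_field_derivative 2 * of_real y * v) (at \<tau>)"
      using DERIV_minus[OF DERIV_power[OF dv, of 2]] by (simp add: v_def ac_simps)
    from DERIV_divide[OF this DERIV_cmult[OF dq, of 4]] q0 show ?thesis
      unfolding q_def[symmetric] v_def[symmetric]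
      by (rule_tac DERIV_cong) (auto simp: field_simps power2_eq_square)
  qed
  have dc: "((\<lambda>\<tau>. csqrt (of_real (4 * pi) * (of_real \<sigma> - \<tau>\<^sup>2))) has_field_derivative
      inverse (2 * c) * (of_real (4 * pi) * (- (2 * \<tau>)))) (at \<tau>)"
    unfolding c_def q_def
    by (rule DERIV_chain2[OF has_field_derivative_csqrt DERIV_cmult[OF dq]]) (use nr q_def in auto)
  \<comment> \<open>Rewritten through \<open>c * c = 4 * pi * q\<close>, the logarithmic derivative
    of the root becomes \<open>- \<tau> / q\<close>, which no longer contains a root.\<close>
  have "inverse (2 * c) * (of_real (4 * pi) * (- (2 * \<tau>))) = c * (- \<tau> / q)"
    using c0 q0 c2 by (simp add: field_simps)
  then have dc': "((\<lambda>\<tau>. csqrt (of_real (4 * pi) * (of_real \<sigma> - \<tau>\<^sup>2))) has_field_derivative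
      c * (- \<tau> / q)) (at \<tau>)"
    using dc by simp
  let ?w = "of_real y * v / (2 * q) - \<tau> * v\<^sup>2 / (2 * q\<^sup>2)"
  let ?e = "exp (- v\<^sup>2 / (4 * q))"
  have "(mehler \<sigma> x y has_field_derivative (?e * ?w * c - ?e * (c * (- \<tau> / q))) / (c * c)) (at \<tau>)"
    unfolding mehler_def[abs_def]
    using DERIV_divide[OF DERIV_chain2[OF DERIV_exp dw] dc'] c0
    by (simp add: c_def q_def v_def)
  moreover have "(?e * ?w * c - ?e * (c * (- \<tau> / q))) / (c * c) = (?w + \<tau> / q) * (?e / c)"
    using c0 by (simp add: field_simps)
  \<comment> \<open>The two summands of the derivative of the exponent combine because
    \<open>y * q - \<tau> * v = \<sigma> * y - \<tau> * x\<close>.\<close>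
  moreover have "?w = - (\<tau> * of_real x - of_real \<sigma> * of_real y) * v / (2 * q\<^sup>2)"
  proof -
    have "of_real y * q - \<tau> * v = - (\<tau> * of_real x - of_real \<sigma> * of_real y)"
      by (simp add: q_def v_def algebra_simps power2_eq_square)
    moreover have "?w = (of_real y * q - \<tau> * v) * v / (2 * q\<^sup>2)"
      using q0 by (simp add: field_simps power2_eq_square)
    ultimately show ?thesis by simp
  qed
  moreover have "?e / c = mehler \<sigma> x y \<tau>" by (simp add: mehler_def c_def q_def v_def)
  ultimately have "(mehler \<sigma> x y has_field_derivative
      (- (\<tau> * of_real x - of_real \<sigma> * of_real y) * v / (2 * q\<^sup>2) + \<tau> / q) * mehler \<sigma> x y \<tau>) (at \<tau>)"
    by metis
  then show ?thesis
    unfolding q_def[symmetric] v_def[symmetric] by (simp only: mult_minus_left minus_divide_left[symmetric] minus_add_cancel add.commute[of _ "\<tau> / q"] diff_conv_add_uminus)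
qed

section \<open>Taylor coefficients from a first-order linear differential equation\<close>

lemma mehler_holomorphic: "mehler \<sigma> x y holomorphic_on ball 0 (sqrt \<sigma>)"
  unfolding holomorphic_on_open[OF open_ball]
  using mehler_has_field_derivative by fastforce

text \<open>With the denominators cleared the coefficients are polynomials in \<open>\<tau>\<close>,
  so the equation passes to formal power series.\<close>

lemma mehler_ode:
  assumes "norm \<tau> < sqrt \<sigma>"
  shows "2 * (of_real \<sigma> - \<tau>\<^sup>2)\<^sup>2 * deriv (mehler \<sigma> x y) \<tau> =
     (2 * \<tau> * (of_real \<sigma> - \<tau>\<^sup>2) - (\<tau> * of_real x - of_real \<sigma> * of_real y) * (of_real x - \<tau> * of_real y))
      * mehler \<sigma> x y \<tau>"
proof -
  define q where "q = complex_of_real \<sigma> - \<tau>\<^sup>2"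
  have q0: "q \<noteq> 0" using Re_sigma_minus[OF assms] unfolding q_def by (metis less_irrefl zero_complex.sel(1))
  show ?thesis
    unfolding DERIV_imp_deriv[OF mehler_has_field_derivative[OF assms]] q_def[symmetric]
    using q0 by (simp add: field_simps power2_eq_square)
qed

text \<open>The coefficient of \<open>X^j\<close> in the equation determines
  \<open>fps_nth P 0 * (j + 1) * fps_nth D (j + 1)\<close> from the earlier coefficients of
  \<open>D\<close>, all of which vanish by induction.\<close>

lemma fps_linear_ode_zero:
  fixes P Q D :: "'a :: {idom, ring_char_0} fps"
  assumes ode: "P * fps_deriv D = Q * D" and P: "fps_nth P 0 \<noteq> 0" and D: "fps_nth D 0 = 0"
  shows "D = 0"
proof -
  have "fps_nth D k = 0" for k
  proof (induction k rule: less_induct)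
    case (less k)
    show ?case
    proof (cases k)
      case 0
      then show ?thesis using D by simp
    next
      case (Suc j)
      have "fps_nth (P * fps_deriv D) j = (\<Sum>i=0..j. fps_nth P i * fps_nth (fps_deriv D) (j - i))"
        by (rule fps_mult_nth)
      also have "\<dots> = (\<Sum>i\<in>{0..j}. if i = 0 then fps_nth P 0 * (of_nat (Suc j) * fps_nth D (Suc j)) else 0)"
        using less.IH Suc by (intro sum.cong) (auto simp: fps_deriv_nth)
      also have "\<dots> = fps_nth P 0 * (of_nat (Suc j) * fps_nth D (Suc j))" by simp
      finally have "fps_nth P 0 * (of_nat (Suc j) * fps_nth D (Suc j)) = fps_nth (Q * D) j"
        using ode by simp
      also have "\<dots> = 0" unfolding fps_mult_nth using less.IH Suc by (intro sum.neutral) auto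
      finally show ?thesis using P Suc of_nat_neq_0[of j] by (simp del: of_nat_Suc)
    qed
  qed
  then show ?thesis by (simp add: fps_eq_iff)
qed

text \<open>
  With \<open>h\<^sub>k\<close>, \<open>g\<^sub>k\<close> the factors of the claimed coefficients, the series \<open>S = \<Sum> h\<^sub>k g\<^sub>k X\<^sup>k\<close>,
  \<open>T = \<Sum> h\<^sub>k g\<^sub>k\<^sub>+\<^sub>1 X\<^sup>k\<close>, \<open>U = \<Sum> h\<^sub>k g\<^sub>k\<^sub>+\<^sub>2 X\<^sup>k\<close> satisfy the three hypotheses by the three-term recurrences.
  Eliminating \<open>T\<close> and \<open>U\<close> leaves the first-order equation that also holds for \<^term>\<open>mehler\<close>.
\<close>

lemma mehler_system_elimination:
  fixes S S' T U x y \<sigma> X :: "'a :: comm_ring_1"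
  assumes 1: "S' = - (y * T) - 2 * (X * U)"
    and 2: "2 * \<sigma> * U = - (x * T) - S - X * S'"
    and 3: "2 * \<sigma> * T = - (x * S) - X * (- (y * S) - 2 * X * T)"
  shows "2 * (\<sigma> - X\<^sup>2)\<^sup>2 * S' = (2 * X * (\<sigma> - X\<^sup>2) - (X * x - \<sigma> * y) * (x - X * y)) * S"
proof -
  have "\<sigma> * S' = - (\<sigma> * y * T) - X * (2 * \<sigma> * U)"
    by (subst 1) (simp add: algebra_simps)
  also have "\<dots> = - (\<sigma> * y * T) + X * (x * T) + X * S + X\<^sup>2 * S'"
    unfolding 2 by (simp add: algebra_simps power2_eq_square)
  finally have A: "(\<sigma> - X\<^sup>2) * S' = (X * x - \<sigma> * y) * T + X * S"
    by (simp add: algebra_simps)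
  have B: "2 * (\<sigma> - X\<^sup>2) * T = - ((x - X * y) * S)"
    using 3 by (simp add: algebra_simps power2_eq_square)
  have "2 * (\<sigma> - X\<^sup>2)\<^sup>2 * S' = 2 * (\<sigma> - X\<^sup>2) * ((\<sigma> - X\<^sup>2) * S')"
    by (simp only: power2_eq_square mult.assoc)
  also have "\<dots> = (X * x - \<sigma> * y) * (2 * (\<sigma> - X\<^sup>2) * T) + 2 * X * (\<sigma> - X\<^sup>2) * S"
    unfolding A by (simp only: distrib_left mult_ac)
  also have "\<dots> = (2 * X * (\<sigma> - X\<^sup>2) - (X * x - \<sigma> * y) * (x - X * y)) * S"
    unfolding B by (simp only: left_diff_distrib mult_minus_right mult.assoc) simp
  finally show ?thesis .
qed

text \<open>Two solutions are compared: the series \<open>S\<close> with the claimed coefficients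
  and the Taylor series \<open>F\<close> of \<open>mehler\<close> both solve
  \<open>P * fps_deriv D = Q * D\<close> with the same constant term. As \<open>P\<close> has
  constant term \<open>2 * \<sigma>\<^sup>2\<close>, their difference is zero.\<close>

lemma mehler_has_fps_expansion:
  assumes s: "\<sigma> > 0"
  shows "mehler \<sigma> x y has_fps_expansion Abs_fps (\<lambda>k. of_real (hermite1 k y * heat_deriv \<sigma> k x))"
proof -
  define S :: "complex fps" where "S = Abs_fps (\<lambda>k. of_real (hermite1 k y * heat_deriv \<sigma> k x))"
  define T :: "complex fps" where "T = Abs_fps (\<lambda>k. of_real (hermite1 k y * heat_deriv \<sigma> (k + 1) x))"
  define U :: "complex fps" where "U = Abs_fps (\<lambda>k. of_real (hermite1 k y * heat_deriv \<sigma> (k + 2) x))"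
  let ?c = "\<lambda>r::real. fps_const (complex_of_real r)"
  let ?X = "fps_X :: complex fps"
  define P where "P = 2 * (?c \<sigma> - ?X\<^sup>2)\<^sup>2"
  define Q where "Q = 2 * ?X * (?c \<sigma> - ?X\<^sup>2) - (?X * ?c x - ?c \<sigma> * ?c y) * (?c x - ?X * ?c y)"
  have g: "2 * \<sigma> * heat_deriv \<sigma> (Suc k) x = - (x * heat_deriv \<sigma> k x + real k * heat_deriv \<sigma> (k - 1) x)" for k
    using s by (simp add: heat_deriv_Suc)
  \<comment> \<open>This is \<open>hermite1_Suc\<close> multiplied by
    \<open>heat_deriv \<sigma> (Suc k) x\<close>; multiplication by \<open>X\<close> accounts for
    the index \<open>k - 1\<close>.\<close>
  have 1: "fps_deriv S = - (?c y * T) - 2 * (?X * U)"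
  proof (rule fps_ext)
    fix k
    have *: "real (Suc k) * (hermite1 (Suc k) y * heat_deriv \<sigma> (Suc k) x) =
       - (y * (hermite1 k y * heat_deriv \<sigma> (k + 1) x)) - 2 * (if k = 0 then 0 else hermite1 (k - 1) y * heat_deriv \<sigma> (k - 1 + 2) x)"
      unfolding mult.assoc[symmetric] hermite1_Suc by (cases k) (simp_all add: algebra_simps)
    show "fps_nth (fps_deriv S) k = fps_nth (- (?c y * T) - 2 * (?X * U)) k"
      using arg_cong[OF *, of complex_of_real] by (cases k) (simp_all add: S_def T_def U_def numeral_fps_const)
  qed
  \<comment> \<open>This is the recurrence of \<open>heat_deriv\<close> at order
    \<open>k + 1\<close>; its factor \<open>k + 1\<close> is the one in the coefficients of
    \<open>S + X * S'\<close>.\<close>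
  have 2: "2 * ?c \<sigma> * U = - (?c x * T) - S - ?X * fps_deriv S"
  proof (rule fps_ext)
    fix k
    have *: "2 * \<sigma> * (hermite1 k y * heat_deriv \<sigma> (k + 2) x) =
       - (x * (hermite1 k y * heat_deriv \<sigma> (k + 1) x)) - (1 + real k) * (hermite1 k y * heat_deriv \<sigma> k x)"
    proof -
      have "2 * \<sigma> * (hermite1 k y * heat_deriv \<sigma> (k + 2) x) = hermite1 k y * (2 * \<sigma> * heat_deriv \<sigma> (Suc (Suc k)) x)" by simp
      also have "\<dots> = - (x * (hermite1 k y * heat_deriv \<sigma> (k + 1) x)) - (1 + real k) * (hermite1 k y * heat_deriv \<sigma> k x)"
        unfolding g by (simp add: algebra_simps)
      finally show ?thesis .
    qed
    show "fps_nth (2 * ?c \<sigma> * U) k = fps_nth (- (?c x * T) - S - ?X * fps_deriv S) k"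
      using arg_cong[OF *, of complex_of_real]
      by (cases k) (simp_all add: S_def T_def U_def numeral_fps_const mult.assoc algebra_simps)
  qed
  \<comment> \<open>Here the recurrence of \<open>heat_deriv\<close> leaves a factor
    \<open>k\<close>, which \<open>hermite1_Suc\<close> absorbs into
    \<open>hermite1 k y\<close>.\<close>
  have 3: "2 * ?c \<sigma> * T = - (?c x * S) - ?X * (- (?c y * S) - 2 * ?X * T)"
  proof (rule fps_ext)
    fix k
    show "fps_nth (2 * ?c \<sigma> * T) k = fps_nth (- (?c x * S) - ?X * (- (?c y * S) - 2 * ?X * T)) k"
    proof (cases k)
      case 0
      have "2 * \<sigma> * (hermite1 0 y * heat_deriv \<sigma> 1 x) = - (x * (hermite1 0 y * heat_deriv \<sigma> 0 x))"
        using g[of 0] by (simp add: hermite1_0)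
      from arg_cong[OF this, of complex_of_real] show ?thesis
        by (simp add: 0 S_def T_def numeral_fps_const mult.assoc)
    next
      case (Suc j)
      have "2 * \<sigma> * (hermite1 k y * heat_deriv \<sigma> (Suc k) x) = hermite1 k y * (2 * \<sigma> * heat_deriv \<sigma> (Suc k) x)" by simp
      also have "\<dots> = - (x * (hermite1 k y * heat_deriv \<sigma> k x)) - (real (Suc j) * hermite1 (Suc j) y) * heat_deriv \<sigma> j x"
        unfolding g Suc by (simp add: algebra_simps)
      also have "\<dots> = - (x * (hermite1 k y * heat_deriv \<sigma> k x)) - (- (y * (hermite1 j y * heat_deriv \<sigma> j x))
          - 2 * (if j = 0 then 0 else hermite1 (j - 1) y * heat_deriv \<sigma> (j - 1 + 1) x))"
        unfolding hermite1_Suc by (cases j) (simp_all add: algebra_simps)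
      finally have *: "2 * \<sigma> * (hermite1 k y * heat_deriv \<sigma> (k + 1) x) = \<dots>" by simp
      have "fps_nth (?X * (- (?c y * S) - 2 * ?X * T)) k = fps_nth (- (?c y * S) - 2 * (?X * T)) j"
        by (simp add: Suc mult.assoc)
      then show ?thesis
        using arg_cong[OF *, of complex_of_real] Suc
        by (cases j) (simp_all add: S_def T_def numeral_fps_const mult.assoc)
    qed
  qed
  have odeS: "P * fps_deriv S = Q * S"
    unfolding P_def Q_def by (rule mehler_system_elimination[OF 1 2 3])
  define F where "F = fps_expansion (mehler \<sigma> x y) 0"
  have exF: "mehler \<sigma> x y has_fps_expansion F"
    unfolding F_def using mehler_holomorphic[of \<sigma> x y] s
    by (intro has_fps_expansion_fps_expansion[of "ball 0 (sqrt \<sigma>)"]) auto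
  have "(\<lambda>\<tau>. 2 * (of_real \<sigma> - \<tau>\<^sup>2)\<^sup>2 * deriv (mehler \<sigma> x y) \<tau>) has_fps_expansion P * fps_deriv F"
    unfolding P_def by (intro fps_expansion_intros exF)
  moreover have ex2: "(\<lambda>\<tau>. (2 * \<tau> * (of_real \<sigma> - \<tau>\<^sup>2) - (\<tau> * of_real x - of_real \<sigma> * of_real y) * (of_real x - \<tau> * of_real y))
      * mehler \<sigma> x y \<tau>) has_fps_expansion Q * F"
    unfolding Q_def by (intro fps_expansion_intros exF)
  \<comment> \<open>The differential equation is known only on a disc, which suffices because an
    expansion at 0 depends only on values near 0.\<close>
  moreover have "eventually (\<lambda>\<tau>. norm \<tau> < sqrt \<sigma>) (nhds (0::complex))"
    using eventually_nhds_in_open[of "ball 0 (sqrt \<sigma>)" "0::complex"] s by simp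
  then have "(\<lambda>\<tau>. 2 * (of_real \<sigma> - \<tau>\<^sup>2)\<^sup>2 * deriv (mehler \<sigma> x y) \<tau>) has_fps_expansion Q * F"
    using ex2 by (subst has_fps_expansion_cong[OF _ refl]) (auto elim!: eventually_mono simp: mehler_ode)
  ultimately have odeF: "P * fps_deriv F = Q * F" by (blast intro: fps_expansion_unique_complex)
  have F0: "fps_nth F 0 = of_real (heat_deriv \<sigma> 0 x)"
  proof -
    have "fps_nth F 0 = mehler \<sigma> x y 0"
      using has_fps_expansion_imp_0_eq_fps_nth_0[OF exF] by simp
    also have "\<dots> = of_real (heat_deriv \<sigma> 0 x)"
      using s by (simp add: mehler_def heat_deriv_0 exp_of_real[symmetric] del: csqrt_of_real
        flip: of_real_mult) (simp add: csqrt_of_real_nonneg)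
    finally show ?thesis .
  qed
  have "S - F = 0"
  proof (rule fps_linear_ode_zero)
    show "P * fps_deriv (S - F) = Q * (S - F)" using odeS odeF by (simp add: algebra_simps)
    show "fps_nth P 0 \<noteq> 0" using s by (simp add: P_def)
    show "fps_nth (S - F) 0 = 0" by (simp add: S_def F0 hermite1_0)
  qed
  then show ?thesis using exF by (simp add: S_def)
qed

text \<open>The point 1 lies in the disc of radius \<open>sqrt (s + 1)\<close> on which
  \<open>mehler (s + 1) x y\<close> is holomorphic, so the Taylor series converges there to the
  value of the function.\<close>

lemma mehler_sums:
  assumes s: "s > 0"
  shows "(\<lambda>k. hermite1 k y * heat_deriv (s + 1) k x) sums heat_deriv s 0 (x - y)"
proof -
  have "(\<lambda>k. fps_nth (Abs_fps (\<lambda>k. of_real (hermite1 k y * heat_deriv (s + 1) k x))) k * 1 ^ k) sums mehler (s + 1) x y 1"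
    using s mehler_holomorphic[of "s + 1" x y]
    by (intro has_fps_expansion_imp_sums_complex[where r = "ereal (sqrt (s + 1))"] mehler_has_fps_expansion) auto
  moreover have "mehler (s + 1) x y 1 = of_real (heat_deriv s 0 (x - y))"
  proof -
    have 1: "- (complex_of_real x - 1 * of_real y)\<^sup>2 / (4 * (of_real (s + 1) - 1\<^sup>2)) = of_real (- (x - y)\<^sup>2 / (4 * s))"
      by simp
    have 2: "of_real (4 * pi) * (complex_of_real (s + 1) - 1\<^sup>2) = of_real (4 * pi * s)"
      by simp
    have 3: "csqrt (of_real (4 * pi * s)) = of_real (sqrt (4 * pi * s))"
      using s by (intro of_real_sqrt[symmetric]) simp
    show ?thesis unfolding mehler_def 1 2 3 exp_of_real
      by (simp only: heat_deriv_0[OF s] of_real_divide)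
  qed
  ultimately have "(\<lambda>k. complex_of_real (hermite1 k y * heat_deriv (s + 1) k x)) sums of_real (heat_deriv s 0 (x - y))" by simp
  then show ?thesis by (simp only: sums_of_real_iff)
qed

text \<open>On this region \<open>q = \<sigma> - \<tau>\<^sup>2\<close> stays comparable to
  \<open>\<sigma>\<close> and \<open>\<tau> * y\<close> is at most \<open>sqrt \<sigma> / 2\<close>.
  In the rescaled variable \<open>u = \<bar>x\<bar> / sqrt \<sigma>\<close> the exponent is then a
  quadratic polynomial with absolute constants, whose leading term wins.\<close>

lemma mehler_norm_bound:
  assumes s: "\<sigma> > 0" and r: "norm \<tau> \<le> sqrt \<sigma> / 2" "norm \<tau> * \<bar>y\<bar> \<le> sqrt \<sigma> / 2"
  shows "norm (mehler \<sigma> x y \<tau>) \<le> exp (- x\<^sup>2 / (20 * \<sigma>)) / sqrt \<sigma>"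
proof -
  define q where "q = complex_of_real \<sigma> - \<tau>\<^sup>2"
  define w where "w = \<tau> * of_real y"
  define u where "u = \<bar>x\<bar> / sqrt \<sigma>"
  have sq: "sqrt \<sigma> > 0" "sqrt \<sigma> * sqrt \<sigma> = \<sigma>" using s by auto
  have u2: "u\<^sup>2 = x\<^sup>2 / \<sigma>" using s by (simp add: u_def power_divide)
  have t2: "norm (\<tau>\<^sup>2) \<le> \<sigma> / 4"
    using power_mono[OF r(1), of 2] s by (simp add: norm_power power_divide)
  have Req: "Re q \<ge> 3 * \<sigma> / 4"
    using complex_Re_le_cmod[of "\<tau>\<^sup>2"] t2 by (simp add: q_def)
  have nq: "norm q \<ge> 3 * \<sigma> / 4" using Req complex_Re_le_cmod[of q] by linarith
  have nq': "norm q \<le> 5 * \<sigma> / 4"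
    using norm_triangle_ineq4[of "of_real \<sigma>" "\<tau>\<^sup>2"] t2 s by (simp add: q_def)
  have q0: "q \<noteq> 0" using nq s by auto
  have inv: "norm (1 / q) \<le> 4 / (3 * \<sigma>)"
    using nq s q0 by (simp add: norm_divide field_simps)
  \<comment> \<open>The constant is \<open>(3/4) / (5/4)\<^sup>2 = 12/25\<close>, from the lower
    bound on \<open>Re q\<close> and the upper bound on \<open>norm q\<close>.\<close>
  have Reinv: "Re (1 / q) \<ge> 12 / (25 * \<sigma>)"
  proof -
    have "12 / (25 * \<sigma>) = (3 * \<sigma> / 4) / (5 * \<sigma> / 4)\<^sup>2" using s by (simp add: field_simps power2_eq_square)
    also have "\<dots> \<le> Re q / (norm q)\<^sup>2"
      using Req nq' q0 s by (intro frac_le power_mono) auto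
    also have "\<dots> = Re (1 / q)" by (simp add: Re_divide cmod_power2)
    finally show ?thesis .
  qed
  have nw: "norm w \<le> sqrt \<sigma> / 2" using r(2) by (simp add: w_def norm_mult)
  have "(of_real x - w)\<^sup>2 / q = of_real (x\<^sup>2) * (1 / q) - 2 * of_real x * w * (1 / q) + w\<^sup>2 * (1 / q)"
    by (simp add: power2_eq_square algebra_simps diff_divide_distrib add_divide_distrib)
  then have "Re ((of_real x - w)\<^sup>2 / q) = x\<^sup>2 * Re (1 / q) - Re (2 * of_real x * w * (1 / q)) + Re (w\<^sup>2 * (1 / q))"
    by (simp only: minus_complex.sel plus_complex.sel Re_complex_of_real times_complex.sel Im_complex_of_real)
  moreover have "x\<^sup>2 * Re (1 / q) \<ge> 12 / 25 * u\<^sup>2"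
    using mult_left_mono[OF Reinv, of "x\<^sup>2"] by (simp add: u2 field_simps)
  moreover have "Re (2 * of_real x * w * (1 / q)) \<le> 4 / 3 * u"
  proof -
    have "Re (2 * of_real x * w * (1 / q)) \<le> norm (2 * of_real x * w * (1 / q))" by (rule complex_Re_le_cmod)
    also have "\<dots> = 2 * \<bar>x\<bar> * norm w * norm (1 / q)" by (simp only: norm_mult) simp
    also have "\<dots> \<le> 2 * \<bar>x\<bar> * (sqrt \<sigma> / 2) * (4 / (3 * \<sigma>))"
      using nw inv s by (intro mult_mono) auto
    also have "\<dots> = 4 / 3 * u" using sq by (simp add: u_def field_simps)
    finally show ?thesis .
  qed
  moreover have "Re (w\<^sup>2 * (1 / q)) \<ge> - 1 / 3"
  proof -
    have "norm (w\<^sup>2 * (1 / q)) = norm w ^ 2 * norm (1 / q)" by (simp add: norm_mult norm_power norm_divide)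
    also have "\<dots> \<le> (sqrt \<sigma> / 2)\<^sup>2 * (4 / (3 * \<sigma>))"
      using nw inv by (intro mult_mono power_mono) auto
    also have "\<dots> = 1 / 3" using s by (simp add: power_divide)
    finally show ?thesis using abs_Re_le_cmod[of "w\<^sup>2 * (1 / q)"] by linarith
  qed
  \<comment> \<open>The two sides differ by \<open>7/25 * (u - 50/21)\<^sup>2 + 5/63\<close>. Giving
    up part of the quadratic term absorbs the linear one.\<close>
  moreover have "12 / 25 * u\<^sup>2 - 4 / 3 * u - 1 / 3 \<ge> u\<^sup>2 / 5 - 2"
  proof -
    have "7 / 25 * u\<^sup>2 - 4 / 3 * u + 5 / 3 = 7 / 25 * (u - 50 / 21)\<^sup>2 + 5 / 63"
      by (simp add: power2_eq_square algebra_simps)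
    then show ?thesis using zero_le_power2[of "u - 50 / 21"] by linarith
  qed
  ultimately have "Re ((of_real x - w)\<^sup>2 / q) \<ge> u\<^sup>2 / 5 - 2" by linarith
  then have e: "norm (exp (- (of_real x - w)\<^sup>2 / (4 * q))) \<le> exp (1 / 2 - u\<^sup>2 / 20)"
  proof -
    assume *: "Re ((of_real x - w)\<^sup>2 / q) \<ge> u\<^sup>2 / 5 - 2"
    have "- (of_real x - w)\<^sup>2 / (4 * q) = of_real (- 1 / 4) * ((of_real x - w)\<^sup>2 / q)" by simp
    then have "Re (- (of_real x - w)\<^sup>2 / (4 * q)) = - Re ((of_real x - w)\<^sup>2 / q) / 4"
      by (simp only: Re_complex_of_real times_complex.sel Im_complex_of_real)
    then show ?thesis using * by (simp add: norm_exp_eq_Re)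
  qed
  \<comment> \<open>Since \<open>pi > 3\<close>, \<open>4 * pi * norm q\<close> is at least
    \<open>12 * (3 * \<sigma> / 4) = 9 * \<sigma>\<close>. The resulting factor 3 in the denominator
    will absorb \<open>exp (1 / 2)\<close>.\<close>
  have c: "norm (csqrt (of_real (4 * pi) * q)) \<ge> 3 * sqrt \<sigma>"
  proof -
    have "sqrt (9 * \<sigma>) \<le> sqrt (4 * pi * norm q)"
    proof -
      have "9 * \<sigma> \<le> 4 * 3 * (3 * \<sigma> / 4)" by simp
      also have "\<dots> \<le> 4 * pi * norm q" using nq s pi_gt3 by (intro mult_mono) auto
      finally show ?thesis by simp
    qed
    then show ?thesis by (simp add: norm_mult real_sqrt_mult)
  qed
  have "norm (mehler \<sigma> x y \<tau>) = norm (exp (- (of_real x - w)\<^sup>2 / (4 * q))) / norm (csqrt (of_real (4 * pi) * q))"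
    by (simp add: mehler_def q_def w_def norm_divide)
  also have "\<dots> \<le> exp (1 / 2 - u\<^sup>2 / 20) / (3 * sqrt \<sigma>)"
    using e c sq by (intro frac_le) auto
  also have "\<dots> = exp (1 / 2) / 3 * (exp (- u\<^sup>2 / 20) / sqrt \<sigma>)"
    by (simp add: exp_add[symmetric])
  also have "\<dots> \<le> 1 * (exp (- u\<^sup>2 / 20) / sqrt \<sigma>)"
    using order_trans[OF _ exp_le, of "exp (1 / 2)"] sq by (intro mult_right_mono) auto
  also have "\<dots> = exp (- x\<^sup>2 / (20 * \<sigma>)) / sqrt \<sigma>" by (simp add: u2 mult.commute)
  finally show ?thesis .
qed

text \<open>Cauchy's inequality on the circle of radius
  \<open>sqrt \<sigma> / (2 * (1 + Y))\<close>, which meets both conditions of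
  \<open>mehler_norm_bound\<close>. A bound \<open>Y\<close> replaces \<open>\<bar>y\<bar>\<close>
  so that all coordinates of a vector can share one radius.\<close>

lemma hermite1_heat_deriv_bound:
  assumes s: "\<sigma> > 0" and Y: "\<bar>y\<bar> \<le> Y"
  shows "\<bar>hermite1 k y * heat_deriv \<sigma> k x\<bar> \<le> exp (- x\<^sup>2 / (20 * \<sigma>)) / sqrt \<sigma> * (2 * (1 + Y) / sqrt \<sigma>) ^ k"
proof -
  define r where "r = sqrt \<sigma> / (2 * (1 + Y))"
  have Y0: "Y \<ge> 0" using Y by linarith
  have r0: "r > 0" using s Y0 by (simp add: r_def)
  have r1: "r \<le> sqrt \<sigma> / 2" unfolding r_def using s Y0 by (intro divide_left_mono) auto
  have r2: "r * \<bar>y\<bar> \<le> sqrt \<sigma> / 2"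
  proof -
    have "r * \<bar>y\<bar> \<le> r * (1 + Y)" using r0 Y by (intro mult_left_mono) auto
    also have "\<dots> = sqrt \<sigma> / 2" using Y0 by (simp add: r_def field_simps)
    finally show ?thesis .
  qed
  have sub: "cball 0 r \<subseteq> ball (0::complex) (sqrt \<sigma>)" 
  proof -
    have "sqrt \<sigma> > 0" using s by simp
    with r1 have "r < sqrt \<sigma>" by linarith
    then show ?thesis by auto
  qed
  have "norm ((deriv ^^ k) (mehler \<sigma> x y) 0) \<le> fact k * (exp (- x\<^sup>2 / (20 * \<sigma>)) / sqrt \<sigma>) / r ^ k"
  proof (rule Cauchy_inequality[OF _ _ r0])
    show "continuous_on (cball 0 r) (mehler \<sigma> x y)"
      using sub by (intro holomorphic_on_imp_continuous_on holomorphic_on_subset[OF mehler_holomorphic])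
    show "mehler \<sigma> x y holomorphic_on ball 0 r"
      using sub ball_subset_cball by (intro holomorphic_on_subset[OF mehler_holomorphic]) (rule order_trans)
    show "norm (mehler \<sigma> x y \<tau>) \<le> exp (- x\<^sup>2 / (20 * \<sigma>)) / sqrt \<sigma>" if "norm (0 - \<tau>) = r" for \<tau>
      using that r1 r2 s by (intro mehler_norm_bound) auto
  qed
  moreover have "(deriv ^^ k) (mehler \<sigma> x y) 0 = fact k * of_real (hermite1 k y * heat_deriv \<sigma> k x)"
    using fps_nth_fps_expansion[OF mehler_has_fps_expansion[OF s, of x y], of k]
    by (simp add: nonzero_eq_divide_eq mult.commute del: of_real_mult)
  ultimately have "fact k * \<bar>hermite1 k y * heat_deriv \<sigma> k x\<bar> \<le> fact k * ((exp (- x\<^sup>2 / (20 * \<sigma>)) / sqrt \<sigma>) / r ^ k)"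
    by (simp add: norm_mult del: of_real_mult)
  then have "\<bar>hermite1 k y * heat_deriv \<sigma> k x\<bar> \<le> (exp (- x\<^sup>2 / (20 * \<sigma>)) / sqrt \<sigma>) / r ^ k"
    by (simp only: mult_le_cancel_left_pos fact_gt_zero)
  also have "\<dots> = exp (- x\<^sup>2 / (20 * \<sigma>)) / sqrt \<sigma> * (1 / r) ^ k" by (simp add: power_one_over)
  also have "1 / r = 2 * (1 + Y) / sqrt \<sigma>" by (simp add: r_def)
  finally show ?thesis .
qed

section \<open>Several variables\<close>

text \<open>The \<open>\<alpha>\<close>-th partial derivative of the heat kernel at time
  \<open>s\<close>, in factorized form; \<open>mi_deriv_heat_mi_deriv\<close> connects it with
  \<open>mi_deriv\<close>.\<close>

definition heat_mi_deriv :: "real \<Rightarrow> ('d::finite \<Rightarrow> nat) \<Rightarrow> real ^ 'd \<Rightarrow> real" where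
  "heat_mi_deriv s \<alpha> x = (\<Prod>i\<in>UNIV. heat_deriv s (\<alpha> i) (x $ i))"

text \<open>Only one factor of the product depends on the coordinate \<open>i\<close>. The scalar
  \<open>c\<close> is carried along because the Gaussian in \<open>hermite\<close> is not
  normalized.\<close>

lemma partial_deriv_heat_mi_deriv:
  fixes x :: "real ^ 'd::finite"
  assumes s: "s > 0"
  shows "partial_deriv i (\<lambda>x. c * heat_mi_deriv s \<alpha> x) x = c * heat_mi_deriv s (\<alpha>(i := Suc (\<alpha> i))) x"
proof -
  let ?r = "\<Prod>j\<in>UNIV - {i}. heat_deriv s (\<alpha> j) (x $ j)"
  have 1: "c * heat_mi_deriv s \<alpha> (x + h *\<^sub>R axis i 1) = c * (heat_deriv s (\<alpha> i) (x $ i + h) * ?r)" for h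
    unfolding heat_mi_deriv_def by (subst prod.remove[of UNIV i]) (auto simp: axis_def intro!: prod.cong)
  have 2: "heat_mi_deriv s (\<alpha>(i := Suc (\<alpha> i))) x = heat_deriv s (Suc (\<alpha> i)) (x $ i) * ?r"
    unfolding heat_mi_deriv_def by (subst prod.remove[of UNIV i]) (auto intro!: prod.cong)
  have "((\<lambda>h. x $ i + h) has_real_derivative 1) (at 0)"
    by (auto intro!: derivative_eq_intros)
  from DERIV_chain2[where f = "heat_deriv s (\<alpha> i)", OF _ this]
  have "((\<lambda>h. heat_deriv s (\<alpha> i) (x $ i + h)) has_real_derivative heat_deriv s (Suc (\<alpha> i)) (x $ i)) (at 0)"
    using has_real_derivative_heat_deriv[OF s, of "\<alpha> i" "x $ i"] by simp
  then have "((\<lambda>h. c * (heat_deriv s (\<alpha> i) (x $ i + h) * ?r)) has_real_derivative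
      c * (heat_deriv s (Suc (\<alpha> i)) (x $ i) * ?r)) (at 0)"
    by (intro DERIV_cmult DERIV_cmult_right)
  then show ?thesis unfolding partial_deriv_def 1 2 by (rule DERIV_imp_deriv)
qed

lemma partial_deriv_funpow_heat_mi_deriv:
  assumes s: "s > 0"
  shows "(partial_deriv i ^^ m) (\<lambda>x. c * heat_mi_deriv s \<alpha> x) = (\<lambda>x. c * heat_mi_deriv s (\<alpha>(i := \<alpha> i + m)) x)"
proof (induction m)
  case (Suc m)
  have "(\<alpha>(i := \<alpha> i + m))(i := Suc ((\<alpha>(i := \<alpha> i + m)) i)) = \<alpha>(i := \<alpha> i + Suc m)" by simp
  then show ?case unfolding funpow.simps comp_def Suc by (simp only: partial_deriv_heat_mi_deriv[OF s] fun_eq_iff) simp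
qed simp

lemma mi_deriv_heat_mi_deriv:
  fixes \<alpha> :: "'d::finite \<Rightarrow> nat"
  assumes s: "s > 0"
  shows "mi_deriv \<alpha> (\<lambda>x. c * heat_mi_deriv s (\<lambda>_. 0) x) = (\<lambda>x. c * heat_mi_deriv s \<alpha> x)"
proof -
  \<comment> \<open>Induction over the list of coordinates: those not yet processed have order 0,
    and distinctness ensures that each coordinate is processed once.\<close>
  have "foldr (\<lambda>i g. (partial_deriv i ^^ \<alpha> i) g) xs (\<lambda>x. c * heat_mi_deriv s (\<lambda>_. 0) x)
     = (\<lambda>x. c * heat_mi_deriv s (\<lambda>i. if i \<in> set xs then \<alpha> i else 0) x)" if "distinct xs" for xs :: "'d list"
    using that
  proof (induction xs)
    case (Cons i xs)
    have "(\<lambda>j. if j \<in> set xs then \<alpha> j else 0)(i := (if i \<in> set xs then \<alpha> i else 0) + \<alpha> i)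
        = (\<lambda>j. if j \<in> set (i # xs) then \<alpha> j else 0)"
      using Cons.prems by auto
    then show ?case using Cons by (simp add: partial_deriv_funpow_heat_mi_deriv[OF s])
  qed simp
  from this[of coord_list] show ?thesis
    using coord_list[where ?'d = 'd] by (simp add: mi_deriv_def)
qed

section \<open>Factorization of Gaussians and Hermite polynomials over the coordinates\<close>

lemma norm_vec_power2: "(norm (x :: real ^ 'd::finite))\<^sup>2 = (\<Sum>i\<in>UNIV. (x $ i)\<^sup>2)"
  by (simp add: norm_vec_def L2_set_def sum_nonneg)

lemma prod_exp_power2:
  fixes x :: "real ^ 'd::finite"
  shows "(\<Prod>i\<in>UNIV. exp (- (x $ i)\<^sup>2 / c)) = exp (- (norm x)\<^sup>2 / c)"
  by (simp add: norm_vec_power2 exp_sum[symmetric] sum_negf sum_divide_distrib)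

lemma inverse_sqrt_power_CARD:
  "c > 0 \<Longrightarrow> (1 / sqrt c) ^ CARD('d::finite) = c powr (- real CARD('d) / 2)"
  by (simp add: powr_half_sqrt[symmetric] powr_realpow[symmetric] powr_powr powr_divide powr_minus_divide)

lemma heat_mi_deriv_0:
  fixes x :: "real ^ 'd::finite"
  assumes "s > 0"
  shows "heat_mi_deriv s (\<lambda>_. 0) x = (4 * pi * s) powr (- real CARD('d) / 2) * exp (- (norm x)\<^sup>2 / (4 * s))"
proof -
  have "heat_mi_deriv s (\<lambda>_. 0) x = (\<Prod>i\<in>UNIV. (1 / sqrt (4 * pi * s)) * exp (- (x $ i)\<^sup>2 / (4 * s)))"
    unfolding heat_mi_deriv_def using assms by (intro prod.cong) (auto simp: heat_deriv_0)
  then show ?thesis using assms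
    by (simp only: prod.distrib prod_exp_power2 prod_constant inverse_sqrt_power_CARD mult_pos_pos pi_gt_zero zero_less_numeral)
qed

lemma heat_mi_deriv_0_pos: "s > 0 \<Longrightarrow> heat_mi_deriv s (\<lambda>_. 0) x > 0"
  by (simp add: heat_mi_deriv_def heat_deriv_0_pos prod_pos)

lemma heat_kernel_eq: "\<nu> * t > 0 \<Longrightarrow> heat_kernel \<nu> t = heat_mi_deriv (\<nu> * t) (\<lambda>_. 0)"
  by (simp add: fun_eq_iff heat_kernel_def heat_mi_deriv_0 mult.assoc)

lemma phi0_eq: "phi0 = heat_mi_deriv 1 (\<lambda>_. 0)"
  by (simp add: fun_eq_iff phi0_def heat_mi_deriv_0)

text \<open>The Gaussian in the definition is \<open>1 / c\<close> times the heat kernel at time 1.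
  The constant cancels in the quotient by that kernel, and numerator, denominator, power of 2 and
  factorial all split into coordinates.\<close>

lemma hermite_eq:
  fixes y :: "real ^ 'd::finite"
  shows "hermite \<alpha> y = (\<Prod>i\<in>UNIV. hermite1 (\<alpha> i) (y $ i))"
proof -
  define c where "c = (4 * pi) powr (- real CARD('d) / 2)"
  have c: "c > 0" by (simp add: c_def)
  have g: "heat_mi_deriv 1 (\<lambda>_. 0) x = c * exp (- (norm x)\<^sup>2 / 4)" for x :: "real ^ 'd"
    by (simp add: heat_mi_deriv_0 c_def)
  have "(\<lambda>y :: real ^ 'd. exp (- (norm y)\<^sup>2 / 4)) = (\<lambda>y. 1 / c * heat_mi_deriv 1 (\<lambda>_. 0) y)"
    using c by (simp add: fun_eq_iff g)
  then have "mi_deriv \<alpha> (\<lambda>y :: real ^ 'd. exp (- (norm y)\<^sup>2 / 4)) y = 1 / c * heat_mi_deriv 1 \<alpha> y"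
    by (simp only: mi_deriv_heat_mi_deriv[OF zero_less_one])
  then have "hermite \<alpha> y = 2 ^ mi_order \<alpha> / mi_fact \<alpha> * (exp ((norm y)\<^sup>2 / 4) * (1 / c * heat_mi_deriv 1 \<alpha> y))"
    by (simp add: hermite_def)
  also have "exp ((norm y)\<^sup>2 / 4) * (1 / c * heat_mi_deriv 1 \<alpha> y) = heat_mi_deriv 1 \<alpha> y / heat_mi_deriv 1 (\<lambda>_. 0) y"
    using c by (simp add: g exp_minus field_simps)
  also have "2 ^ mi_order \<alpha> / mi_fact \<alpha> * (heat_mi_deriv 1 \<alpha> y / heat_mi_deriv 1 (\<lambda>_. 0) y)
      = (\<Prod>i\<in>UNIV. hermite1 (\<alpha> i) (y $ i))"
    by (simp add: hermite1_def heat_mi_deriv_def mi_order_def mi_fact_def prod_dividef prod.distrib power_sum)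
  finally show ?thesis .
qed

text \<open>Fubini for a product of functions of single coordinates. Lebesgue measure is the image
  of a product measure indexed by \<open>Basis\<close>, and \<open>e\<close> translates between that
  index set and \<open>'d\<close>.\<close>

lemma lborel_integral_prod_vec:
  fixes f :: "'d::finite \<Rightarrow> real \<Rightarrow> real"
  assumes int: "\<And>i. integrable lborel (f i)"
  shows "integrable lborel (\<lambda>x :: real ^ 'd. \<Prod>i\<in>UNIV. f i (x $ i))"
    and "(LINT x|lborel. (\<Prod>i\<in>UNIV. f i ((x :: real ^ 'd) $ i))) = (\<Prod>i\<in>UNIV. LINT x|lborel. f i x)"
proof -
  interpret product_sigma_finite "\<lambda>_ :: real ^ 'd. lborel :: real measure" ..
  define e where "e = (\<lambda>i :: 'd. axis i (1 :: real))"
  define g where "g b = f (inv e b)" for b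
  have inj: "inj e" by (auto simp: inj_on_def e_def axis_eq_axis)
  have B: "Basis = range e" by (auto simp: Basis_vec_def e_def)
  have inv: "inv e (e i) = i" for i using inj by simp
  have nth: "(\<Sum>b\<in>Basis. h b *\<^sub>R b) $ i = h (e i)" for h :: "real ^ 'd \<Rightarrow> real" and i
  proof -
    have "(\<Sum>b\<in>Basis. h b *\<^sub>R b) $ i = (\<Sum>b\<in>Basis. h b *\<^sub>R b) \<bullet> e i"
      by (simp add: e_def inner_axis)
    also have "\<dots> = h (e i)" by (rule inner_sum_left_Basis) (simp add: B)
    finally show ?thesis .
  qed
  have P: "(\<Prod>i\<in>UNIV. f i ((\<Sum>b\<in>Basis. h b *\<^sub>R b) $ i)) = (\<Prod>b\<in>Basis. g b (h b))" for h :: "real ^ 'd \<Rightarrow> real"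
    unfolding nth unfolding B by (subst prod.reindex[OF inj]) (simp add: g_def inv)
  have [measurable]: "f i \<in> borel_measurable borel" for i
    using borel_measurable_integrable[OF int[of i]] by simp
  have M: "(\<lambda>x :: real ^ 'd. \<Prod>i\<in>UNIV. f i (x $ i)) \<in> borel_measurable borel"
    by measurable
  have S: "(\<lambda>f. \<Sum>b\<in>Basis. f b *\<^sub>R b) \<in> measurable (\<Pi>\<^sub>M b\<in>Basis. lborel) (borel :: (real ^ 'd) measure)"
    by measurable
  have G: "integrable lborel (g b)" for b by (simp add: g_def int)
  show "integrable lborel (\<lambda>x :: real ^ 'd. \<Prod>i\<in>UNIV. f i (x $ i))"
    unfolding lborel_eq[where ?'a = "real ^ 'd"] integrable_distr_eq[OF S M] P
    by (intro product_integrable_prod) (auto intro: G)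
  have "(LINT x|lborel. (\<Prod>i\<in>UNIV. f i ((x :: real ^ 'd) $ i))) = (\<Prod>b\<in>Basis. LINT x|lborel. g b x)"
    unfolding lborel_eq[where ?'a = "real ^ 'd"] integral_distr[OF S M] P
    by (intro product_integral_prod) (auto intro: G)
  also have "\<dots> = (\<Prod>i\<in>UNIV. LINT x|lborel. f i x)"
    unfolding B by (subst prod.reindex[OF inj]) (simp add: g_def inv)
  finally show "(LINT x|lborel. (\<Prod>i\<in>UNIV. f i ((x :: real ^ 'd) $ i))) = (\<Prod>i\<in>UNIV. LINT x|lborel. f i x)" .
qed

section \<open>Convolution with \<open>phi0\<close>, and sums over multi-indices\<close>

lemma borel_measurable_heat_mi_deriv [measurable]: "s > 0 \<Longrightarrow> heat_mi_deriv s \<alpha> \<in> borel_measurable borel"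
  unfolding heat_mi_deriv_def[abs_def] using borel_measurable_heat_deriv[of s] by measurable

lemma borel_measurable_hermite [measurable]: "hermite \<alpha> \<in> borel_measurable borel"
  unfolding hermite_eq[abs_def] by measurable

text \<open>\<open>phi0\<close> is the heat kernel at time 1, so convolution with it advances the
  time by 1. The integral factorizes and each coordinate is covered by
  \<open>heat_deriv_convolution\<close>.\<close>

lemma conv_mi_deriv_heat_kernel_phi0:
  fixes x :: "real ^ 'd::finite"
  assumes st: "\<nu> * t > 0"
  shows "conv (mi_deriv \<alpha> (heat_kernel \<nu> t)) phi0 x = heat_mi_deriv (\<nu> * t + 1) \<alpha> x"
proof -
  define s where "s = \<nu> * t"
  have s: "s > 0" using st by (simp add: s_def)
  note [measurable] = borel_measurable_heat_mi_deriv[OF s] borel_measurable_heat_mi_deriv[OF zero_less_one]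
  have "mi_deriv \<alpha> (heat_kernel \<nu> t) = heat_mi_deriv s \<alpha>"
    using mi_deriv_heat_mi_deriv[OF s, of \<alpha> 1] st by (simp add: heat_kernel_eq s_def)
  then have "conv (mi_deriv \<alpha> (heat_kernel \<nu> t)) phi0 x = (LINT y|lborel. heat_mi_deriv s \<alpha> (x - y) * heat_mi_deriv 1 (\<lambda>_. 0) y)"
    unfolding conv_def phi0_eq by (subst integral_completion) auto
  also have "\<dots> = (LINT y|lborel. (\<Prod>i\<in>UNIV. heat_deriv s (\<alpha> i) (x $ i - y $ i) * heat_deriv 1 0 (y $ i)))"
    by (simp add: heat_mi_deriv_def prod.distrib)
  also have "\<dots> = (\<Prod>i\<in>UNIV. LINT z|lborel. heat_deriv s (\<alpha> i) (x $ i - z) * heat_deriv 1 0 z)"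
    by (intro lborel_integral_prod_vec integrable_heat_deriv_mult s zero_less_one)
  also have "\<dots> = heat_mi_deriv (s + 1) \<alpha> x"
    by (simp add: heat_deriv_convolution[OF s] heat_mi_deriv_def)
  finally show ?thesis by (simp add: s_def)
qed

lemma hermite_bound:
  "\<exists>C\<ge>0. \<forall>y :: real ^ 'd::finite. \<bar>hermite \<alpha> y\<bar> \<le> C * (1 + norm y) ^ mi_order \<alpha>"
proof -
  obtain C where C: "\<And>k. C k \<ge> 0" "\<And>k y. \<bar>hermite1 k y\<bar> \<le> C k * (1 + \<bar>y\<bar>) ^ k"
    using hermite1_bound by metis
  have "\<bar>hermite \<alpha> y\<bar> \<le> (\<Prod>i\<in>UNIV. C (\<alpha> i)) * (1 + norm y) ^ mi_order \<alpha>" for y :: "real ^ 'd"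
  proof -
    have "\<bar>hermite \<alpha> y\<bar> \<le> (\<Prod>i\<in>UNIV. C (\<alpha> i) * (1 + norm y) ^ \<alpha> i)"
      unfolding hermite_eq abs_prod
    proof (intro prod_mono conjI)
      fix i
      have "C (\<alpha> i) * (1 + \<bar>y $ i\<bar>) ^ \<alpha> i \<le> C (\<alpha> i) * (1 + norm y) ^ \<alpha> i"
        using C(1) component_le_norm_cart[of y i] by (intro mult_left_mono power_mono) auto
      then show "\<bar>hermite1 (\<alpha> i) (y $ i)\<bar> \<le> C (\<alpha> i) * (1 + norm y) ^ \<alpha> i" using C(2)[of "\<alpha> i" "y $ i"] by linarith
    qed simp
    then show ?thesis by (simp add: prod.distrib power_sum mi_order_def)
  qed
  then show ?thesis using C(1) by (intro exI[of _ "\<Prod>i\<in>UNIV. C (\<alpha> i)"]) (auto intro: prod_nonneg)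
qed

lemma hermite_heat_mi_deriv_bound:
  fixes x y :: "real ^ 'd::finite"
  assumes s: "\<sigma> > 0"
  shows "\<bar>hermite \<alpha> y * heat_mi_deriv \<sigma> \<alpha> x\<bar> \<le>
     \<sigma> powr (- real CARD('d) / 2) * exp (- (norm x)\<^sup>2 / (20 * \<sigma>)) * (2 * (1 + norm y) / sqrt \<sigma>) ^ mi_order \<alpha>"
proof -
  have "\<bar>hermite \<alpha> y * heat_mi_deriv \<sigma> \<alpha> x\<bar> = (\<Prod>i\<in>UNIV. \<bar>hermite1 (\<alpha> i) (y $ i) * heat_deriv \<sigma> (\<alpha> i) (x $ i)\<bar>)"
    by (simp add: hermite_eq heat_mi_deriv_def abs_prod abs_mult prod.distrib)
  also have "\<dots> \<le> (\<Prod>i\<in>UNIV. (1 / sqrt \<sigma>) * exp (- (x $ i)\<^sup>2 / (20 * \<sigma>)) * (2 * (1 + norm y) / sqrt \<sigma>) ^ \<alpha> i)"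
    using hermite1_heat_deriv_bound[OF s component_le_norm_cart] by (intro prod_mono) auto
  also have "\<dots> = (1 / sqrt \<sigma>) ^ CARD('d) * exp (- (norm x)\<^sup>2 / (20 * \<sigma>)) * (2 * (1 + norm y) / sqrt \<sigma>) ^ mi_order \<alpha>"
    by (simp only: prod.distrib prod_exp_power2 prod_constant power_sum mi_order_def)
  finally show ?thesis by (simp only: inverse_sqrt_power_CARD[OF s])
qed

text \<open>The sum over multi-indices is the \<open>CARD('d)\<close>-th power of the geometric
  series with value 2.\<close>

lemma has_sum_geometric_mi:
  "((\<lambda>\<alpha> :: 'd::finite \<Rightarrow> nat. (1 / 2 :: real) ^ mi_order \<alpha>) has_sum 2 ^ CARD('d)) UNIV"
proof -
  have g: "((\<lambda>k. (1 / 2 :: real) ^ k) has_sum 2) UNIV"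
    using geometric_sums[of "1 / 2 :: real"]
    by (intro norm_summable_imp_has_sum) (simp_all add: summable_geometric)
  then have "(\<lambda>k. norm ((1 / 2 :: real) ^ k)) summable_on UNIV"
    by (auto simp: summable_on_def)
  then have "infsum (\<lambda>\<alpha>. \<Prod>i\<in>UNIV. (1 / 2 :: real) ^ \<alpha> i) (PiE UNIV (\<lambda>_ :: 'd. UNIV)) = (\<Prod>i\<in>(UNIV :: 'd set). infsum (\<lambda>k. (1 / 2 :: real) ^ k) UNIV)"
    by (intro infsum_prod_PiE_abs) auto
  then have inf: "infsum (\<lambda>\<alpha> :: 'd \<Rightarrow> nat. (1 / 2 :: real) ^ mi_order \<alpha>) UNIV = 2 ^ CARD('d)"
    using infsumI[OF g] by (simp add: mi_order_def power_sum del: power_one_over)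
  \<comment> \<open>An infinite sum that does not exist has the default value 0, so the nonzero
    value found above implies summability.\<close>
  then have "(\<lambda>\<alpha> :: 'd \<Rightarrow> nat. (1 / 2 :: real) ^ mi_order \<alpha>) summable_on UNIV"
    using infsum_not_exists by fastforce
  with inf show ?thesis using has_sum_infsum by metis
qed

text \<open>For ratio at most \<open>1 / 2\<close> the series in each coordinate converges
  absolutely, so their product may be expanded into a sum over multi-indices.\<close>

lemma mehler_multi:
  fixes x y :: "real ^ 'd::finite"
  assumes s: "s > 0" and \<rho>: "2 * (1 + norm y) / sqrt (s + 1) \<le> 1 / 2"
  shows "((\<lambda>\<alpha>. hermite \<alpha> y * heat_mi_deriv (s + 1) \<alpha> x) has_sum heat_mi_deriv s (\<lambda>_. 0) (x - y)) UNIV"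
proof -
  let ?\<rho> = "2 * (1 + norm y) / sqrt (s + 1)"
  have \<rho>0: "?\<rho> \<ge> 0" using s by simp
  have 1: "((\<lambda>k. hermite1 k (y $ i) * heat_deriv (s + 1) k (x $ i)) has_sum heat_deriv s 0 (x $ i - y $ i)) UNIV"
    and 2: "(\<lambda>k. norm (hermite1 k (y $ i) * heat_deriv (s + 1) k (x $ i))) summable_on UNIV" for i
  proof -
    let ?M = "exp (- (x $ i)\<^sup>2 / (20 * (s + 1))) / sqrt (s + 1)"
    have "summable (\<lambda>k. ?M * (1 / 2) ^ k)" by (intro summable_mult summable_geometric) simp
    moreover have "norm (norm (hermite1 k (y $ i) * heat_deriv (s + 1) k (x $ i))) \<le> ?M * (1 / 2) ^ k" for k
    proof -
      have "norm (norm (hermite1 k (y $ i) * heat_deriv (s + 1) k (x $ i))) \<le> ?M * ?\<rho> ^ k"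
        using hermite1_heat_deriv_bound[of "s + 1" "y $ i" "norm y" k "x $ i"] component_le_norm_cart[of y i] s by simp
      also have "\<dots> \<le> ?M * (1 / 2) ^ k"
        using \<rho> \<rho>0 s by (intro mult_left_mono power_mono) auto
      finally show ?thesis .
    qed
    ultimately have sm: "summable (\<lambda>k. norm (hermite1 k (y $ i) * heat_deriv (s + 1) k (x $ i)))"
      by (rule summable_comparison_test'[where N = 0])
    then show "((\<lambda>k. hermite1 k (y $ i) * heat_deriv (s + 1) k (x $ i)) has_sum heat_deriv s 0 (x $ i - y $ i)) UNIV"
      using mehler_sums[OF s] by (rule norm_summable_imp_has_sum)
    show "(\<lambda>k. norm (hermite1 k (y $ i) * heat_deriv (s + 1) k (x $ i))) summable_on UNIV"
      using sm by (subst summable_on_UNIV_nonneg_real_iff) auto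
  qed
  have "infsum (\<lambda>\<alpha>. \<Prod>i\<in>UNIV. hermite1 (\<alpha> i) (y $ i) * heat_deriv (s + 1) (\<alpha> i) (x $ i)) (PiE UNIV (\<lambda>_ :: 'd. UNIV))
      = (\<Prod>i\<in>UNIV. infsum (\<lambda>k. hermite1 k (y $ i) * heat_deriv (s + 1) k (x $ i)) UNIV)"
    using 2 by (intro infsum_prod_PiE_abs) auto
  also have "\<dots> = heat_mi_deriv s (\<lambda>_. 0) (x - y)"
    by (simp add: infsumI[OF 1] heat_mi_deriv_def)
  finally have inf: "infsum (\<lambda>\<alpha>. hermite \<alpha> y * heat_mi_deriv (s + 1) \<alpha> x) UNIV = heat_mi_deriv s (\<lambda>_. 0) (x - y)"
    by (simp add: hermite_eq heat_mi_deriv_def prod.distrib)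
  \<comment> \<open>Summability again follows from a nonzero sum: the heat kernel is
    positive.\<close>
  moreover have "(\<lambda>\<alpha>. hermite \<alpha> y * heat_mi_deriv (s + 1) \<alpha> x) summable_on UNIV"
    using infsum_not_exists[of "\<lambda>\<alpha>. hermite \<alpha> y * heat_mi_deriv (s + 1) \<alpha> x" UNIV] inf heat_mi_deriv_0_pos[OF s, of "x - y"] by force
  ultimately show ?thesis using has_sum_infsum by metis
qed

section \<open>The kernel of the remainder\<close>

definition remainder_kernel :: "nat \<Rightarrow> real \<Rightarrow> real ^ 'd::finite \<Rightarrow> real ^ 'd \<Rightarrow> real" where
  "remainder_kernel N s x y =
     heat_mi_deriv s (\<lambda>_. 0) (x - y) - (\<Sum>\<alpha> | mi_order \<alpha> \<le> N. hermite \<alpha> y * heat_mi_deriv (s + 1) \<alpha> x)"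

text \<open>The kernel is the tail of the series of \<open>mehler_multi\<close>. Half of the
  smallness of \<open>\<rho>\<close> is spent on summing over multi-indices, the rest gives the
  power \<open>Suc N\<close>.\<close>

lemma remainder_kernel_far:
  fixes x y :: "real ^ 'd::finite"
  assumes s: "s > 0" and \<rho>: "2 * (1 + norm y) / sqrt (s + 1) \<le> 1 / 2"
  shows "\<bar>remainder_kernel N s x y\<bar> \<le> 2 ^ CARD('d) * (4 * (1 + norm y) / sqrt (s + 1)) ^ Suc N
     * ((s + 1) powr (- real CARD('d) / 2) * exp (- (norm x)\<^sup>2 / (20 * (s + 1))))"
proof -
  define c where "c \<alpha> = hermite \<alpha> y * heat_mi_deriv (s + 1) \<alpha> x" for \<alpha>
  define \<rho> where "\<rho> = 2 * (1 + norm y) / sqrt (s + 1)"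
  define D where "D = (s + 1) powr (- real CARD('d) / 2) * exp (- (norm x)\<^sup>2 / (20 * (s + 1)))"
  define A where "A = {\<alpha> :: 'd \<Rightarrow> nat. mi_order \<alpha> \<le> N}"
  define g where "g \<alpha> = D * (2 * \<rho>) ^ Suc N * (1 / 2) ^ mi_order \<alpha>" for \<alpha> :: "'d \<Rightarrow> nat"
  have r: "0 \<le> \<rho>" "\<rho> \<le> 1 / 2" using \<rho> s by (simp_all add: \<rho>_def)
  have D: "D \<ge> 0" by (simp add: D_def)
  have fin: "finite A" unfolding A_def by (rule finite_mi_order_le)
  have hs: "(c has_sum heat_mi_deriv s (\<lambda>_. 0) (x - y)) UNIV"
    unfolding c_def using mehler_multi[OF s \<rho>] .
  have "(c has_sum heat_mi_deriv s (\<lambda>_. 0) (x - y) - sum c A) (UNIV - A)"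
    by (rule has_sum_Diff[OF hs]) (auto intro: has_sum_finite fin)
  then have hd: "(c has_sum remainder_kernel N s x y) (UNIV - A)"
    by (simp add: remainder_kernel_def A_def c_def)
  have le: "norm (c \<alpha>) \<le> g \<alpha>" if "\<alpha> \<in> UNIV - A" for \<alpha>
  proof -
    have k: "mi_order \<alpha> \<ge> Suc N" using that by (auto simp: A_def)
    have "norm (c \<alpha>) \<le> D * \<rho> ^ mi_order \<alpha>"
      unfolding c_def D_def \<rho>_def real_norm_def
      by (rule hermite_heat_mi_deriv_bound) (use s in simp)
    \<comment> \<open>Since \<open>2 * \<rho> \<le> 1\<close>, the first factor is at most
      \<open>(2 * \<rho>) ^ Suc N\<close> for every order in the tail, while the second is
      summable.\<close>
    also have "\<rho> ^ mi_order \<alpha> = (2 * \<rho>) ^ mi_order \<alpha> * (1 / 2) ^ mi_order \<alpha>"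
      by (subst power_mult_distrib[symmetric]) simp
    also have "D * \<dots> \<le> D * ((2 * \<rho>) ^ Suc N * (1 / 2) ^ mi_order \<alpha>)"
      using r D k by (intro mult_left_mono mult_right_mono power_decreasing) auto
    finally show ?thesis by (simp add: g_def)
  qed
  have "(g has_sum D * (2 * \<rho>) ^ Suc N * 2 ^ CARD('d)) UNIV"
    unfolding g_def by (intro has_sum_cmult_right has_sum_geometric_mi)
  then have gs: "g summable_on UNIV" "infsum g UNIV = D * (2 * \<rho>) ^ Suc N * 2 ^ CARD('d)"
    by (auto simp: summable_on_def infsumI)
  have gA: "g summable_on (UNIV - A)" using gs(1) by (rule summable_on_subset_banach) auto
  have cs: "(\<lambda>\<alpha>. norm (c \<alpha>)) summable_on (UNIV - A)"
    by (rule Infinite_Sum.abs_summable_on_comparison_test'[OF gA le])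
  have "\<bar>remainder_kernel N s x y\<bar> \<le> infsum (\<lambda>\<alpha>. norm (c \<alpha>)) (UNIV - A)"
    using norm_infsum_bound[OF cs] infsumI[OF hd] by simp
  also have "\<dots> \<le> infsum g UNIV"
    using cs gs(1) le D r by (intro infsum_mono_neutral) (auto simp: g_def)
  finally show ?thesis using gs(2) by (simp add: D_def \<rho>_def mult_ac)
qed

text \<open>With \<open>u = v / sqrt a\<close>, the bound follows from \<open>ln u \<le> u\<close>
  and \<open>\<mu> * u \<le> 10 * \<mu>\<^sup>2 + u\<^sup>2 / 40\<close>, which is
  \<open>(20 * \<mu> - u)\<^sup>2 \<ge> 0\<close>.\<close>

lemma powr_le_gauss:
  fixes v a \<mu> :: real
  assumes v: "v \<ge> 0" and a: "a > 0" and \<mu>: "\<mu> \<ge> 0"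
  shows "v powr \<mu> \<le> exp (10 * \<mu>\<^sup>2) * a powr (\<mu> / 2) * exp (v\<^sup>2 / (40 * a))"
proof (cases "v = 0")
  case False
  define u where "u = v / sqrt a"
  have u: "u > 0" using v a False by (simp add: u_def)
  have u2: "u\<^sup>2 = v\<^sup>2 / a" using a by (simp add: u_def power_divide)
  have "v powr \<mu> = (u * sqrt a) powr \<mu>" using a by (simp add: u_def)
  also have "\<dots> = u powr \<mu> * a powr (\<mu> / 2)"
    using u a by (simp add: powr_mult powr_half_sqrt[symmetric] powr_powr)
  also have "u powr \<mu> \<le> exp (10 * \<mu>\<^sup>2 + v\<^sup>2 / (40 * a))"
  proof -
    have "\<mu> * ln u \<le> \<mu> * u" using \<mu> ln_le_minus_one[OF u] by (intro mult_left_mono) auto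
    also have "\<mu> * u \<le> 10 * \<mu>\<^sup>2 + u\<^sup>2 / 40"
      using zero_le_power2[of "20 * \<mu> - u"] by (simp add: power2_eq_square algebra_simps)
    finally show ?thesis using u by (simp add: powr_def u2 mult.commute)
  qed
  finally show ?thesis using a by (simp add: exp_add mult_ac mult_right_mono)
qed simp

lemma powr_norm_le_split:
  fixes x y :: "'a :: real_normed_vector"
  assumes \<mu>: "\<mu> \<ge> 0"
  shows "norm x powr \<mu> \<le> 2 powr \<mu> * (norm (x - y) powr \<mu> + norm y powr \<mu>)"
proof -
  have "norm x \<le> norm (x - y) + norm y" using norm_triangle_ineq[of "x - y" y] by simp
  then have "norm x \<le> 2 * max (norm (x - y)) (norm y)" by linarith
  then have "norm x powr \<mu> \<le> (2 * max (norm (x - y)) (norm y)) powr \<mu>"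
    using \<mu> by (intro powr_mono2) auto
  also have "\<dots> = 2 powr \<mu> * max (norm (x - y)) (norm y) powr \<mu>"
    by (simp add: powr_mult le_max_iff_disj)
  also have "\<dots> \<le> 2 powr \<mu> * (norm (x - y) powr \<mu> + norm y powr \<mu>)"
    by (intro mult_left_mono) (auto simp: max_def)
  finally show ?thesis .
qed

text \<open>The first Gaussian, centred at \<open>y\<close>, dominates the heat kernel; the second,
  centred at 0, dominates the Hermite terms. The 40 in place of 20 is what remains after half of the
  exponent has absorbed the weight, as in \<open>weighted_gauss_bound\<close>.\<close>

definition gauss_pair :: "real \<Rightarrow> real ^ 'd::finite \<Rightarrow> real ^ 'd \<Rightarrow> real" where
  "gauss_pair s x y = s powr (- real CARD('d) / 2) * exp (- (norm (x - y))\<^sup>2 / (40 * s))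
     + (s + 1) powr (- real CARD('d) / 2) * exp (- (norm x)\<^sup>2 / (40 * (s + 1)))"

lemma weighted_gauss_bound:
  fixes x :: "real ^ 'd::finite"
  assumes a: "a > 0" and \<mu>: "\<mu> \<ge> 0"
  shows "norm x powr \<mu> * exp (- (norm x)\<^sup>2 / (20 * a)) \<le>
    exp (10 * \<mu>\<^sup>2) * a powr (\<mu> / 2) * exp (- (norm x)\<^sup>2 / (40 * a))"
proof -
  have "norm x powr \<mu> * exp (- (norm x)\<^sup>2 / (20 * a)) \<le>
     exp (10 * \<mu>\<^sup>2) * a powr (\<mu> / 2) * exp ((norm x)\<^sup>2 / (40 * a)) * exp (- (norm x)\<^sup>2 / (20 * a))"
    using powr_le_gauss[OF norm_ge_zero a \<mu>] by (intro mult_right_mono) auto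
  also have "\<dots> = exp (10 * \<mu>\<^sup>2) * a powr (\<mu> / 2) * exp (- (norm x)\<^sup>2 / (40 * a))"
  proof -
    have "(norm x)\<^sup>2 / (40 * a) + - (norm x)\<^sup>2 / (20 * a) = - (norm x)\<^sup>2 / (40 * a)"
      using a by (simp add: field_simps)
    then show ?thesis by (simp only: mult.assoc exp_add[symmetric])
  qed
  finally show ?thesis .
qed

text \<open>With \<open>r = 2 * \<rho>\<close>, both regimes aim at the same quantity
  \<open>W = r powr n * \<sigma> powr (\<mu> / 2)\<close>. For \<open>r \<le> 1\<close> the tail
  estimate applies, as \<open>n \<le> N + 1\<close>. For \<open>r \<ge> 1\<close> each term is
  bounded alone, as its order and \<open>\<mu>\<close> are at most \<open>n\<close>.\<close>

lemma remainder_kernel_bound: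
  fixes n \<mu> :: real
  assumes \<mu>: "0 \<le> \<mu>" "\<mu> \<le> n"
  shows "\<exists>C\<ge>0. \<forall>s>0. \<forall>x y :: real ^ 'd::finite.
    norm x powr \<mu> * \<bar>remainder_kernel (nat \<lfloor>n\<rfloor>) s x y\<bar>
      \<le> C * (1 + norm y) powr n * s powr (- (n - \<mu>) / 2) * gauss_pair s x y"
proof -
  define N where "N = nat \<lfloor>n\<rfloor>"
  have n0: "n \<ge> 0" using \<mu> by linarith
  have N: "real N \<le> n" "n \<le> real (Suc N)" using n0 floor_correct[of n] by (simp_all add: N_def add.commute)
  define A where "A = {\<alpha> :: 'd \<Rightarrow> nat. mi_order \<alpha> \<le> N}"
  define K where "K = exp (10 * \<mu>\<^sup>2)"
  define M where "M = real (card A) + 2 ^ CARD('d)"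
  \<comment> \<open>The first summand serves the heat kernel term; \<open>M * K\<close> serves both
    the finitely many Hermite terms and the tail.\<close>
  define C where "C = 2 powr \<mu> * (K + 1) + M * K"
  have K: "K \<ge> 0" and M: "M \<ge> 0" by (simp_all add: K_def M_def)
  have C1: "2 powr \<mu> * (K + 1) \<le> C" "M * K \<le> C" and C0: "C \<ge> 0" using K M by (simp_all add: C_def)
  have "norm x powr \<mu> * \<bar>remainder_kernel N s x y\<bar>
      \<le> C * 4 powr n * (1 + norm y) powr n * s powr (- (n - \<mu>) / 2) * gauss_pair s x y"
    if s: "s > 0" for s and x y :: "real ^ 'd"
  proof -
    define \<sigma> where "\<sigma> = s + 1"
    have \<sigma>: "\<sigma> > 0" "s \<le> \<sigma>" using s by (simp_all add: \<sigma>_def)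
    define r where "r = 4 * (1 + norm y) / sqrt \<sigma>"
    have y0: "1 + norm y > 0" using norm_ge_zero[of y] by linarith
    have r: "r > 0" using \<sigma> y0 by (simp add: r_def)
    define W where "W = r powr n * \<sigma> powr (\<mu> / 2)"
    have W0: "W \<ge> 0" by (simp add: W_def)
    define G1 where "G1 = s powr (- real CARD('d) / 2) * exp (- (norm (x - y))\<^sup>2 / (40 * s))"
    define G2 where "G2 = \<sigma> powr (- real CARD('d) / 2) * exp (- (norm x)\<^sup>2 / (40 * \<sigma>))"
    have G: "G1 \<ge> 0" "G2 \<ge> 0" by (simp_all add: G1_def G2_def)
    define D where "D = \<sigma> powr (- real CARD('d) / 2) * exp (- (norm x)\<^sup>2 / (20 * \<sigma>))"
    have D: "norm x powr \<mu> * D \<le> K * \<sigma> powr (\<mu> / 2) * G2"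
    proof -
      have "norm x powr \<mu> * D = \<sigma> powr (- real CARD('d) / 2) * (norm x powr \<mu> * exp (- (norm x)\<^sup>2 / (20 * \<sigma>)))"
        by (simp add: D_def)
      also have "\<dots> \<le> \<sigma> powr (- real CARD('d) / 2) * (K * \<sigma> powr (\<mu> / 2) * exp (- (norm x)\<^sup>2 / (40 * \<sigma>)))"
        unfolding K_def using weighted_gauss_bound[OF \<sigma>(1) \<mu>(1)] by (intro mult_left_mono) auto
      finally show ?thesis by (simp add: G2_def mult_ac)
    qed
    have key: "norm x powr \<mu> * \<bar>remainder_kernel N s x y\<bar> \<le> C * W * (G1 + G2)"
    proof (cases "r \<le> 1")
      case True
      have "\<bar>remainder_kernel N s x y\<bar> \<le> 2 ^ CARD('d) * r ^ Suc N * D"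
        unfolding r_def D_def \<sigma>_def using True s
        by (intro remainder_kernel_far) (auto simp: r_def \<sigma>_def)
      also have "\<dots> \<le> 2 ^ CARD('d) * r powr n * D"
      proof -
        have "r ^ Suc N = r powr real (Suc N)" using r by (simp only: powr_realpow)
        also have "\<dots> \<le> r powr n" using powr_mono'[OF N(2), of r] r True by simp
        finally show ?thesis by (intro mult_left_mono mult_right_mono) (auto simp: D_def)
      qed
      finally have "norm x powr \<mu> * \<bar>remainder_kernel N s x y\<bar> \<le> norm x powr \<mu> * (2 ^ CARD('d) * r powr n * D)"
        by (intro mult_left_mono) auto
      also have "\<dots> = 2 ^ CARD('d) * r powr n * (norm x powr \<mu> * D)" by simp
      also have "\<dots> \<le> 2 ^ CARD('d) * r powr n * (K * \<sigma> powr (\<mu> / 2) * G2)"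
        using D by (intro mult_left_mono) auto
      also have "\<dots> = (2 ^ CARD('d) * K) * W * G2" by (simp add: W_def)
      also have "\<dots> \<le> C * W * (G1 + G2)"
      proof -
        have "2 ^ CARD('d) * K \<le> M * K" using K by (simp add: M_def mult_right_mono)
        then show ?thesis using C1(2) C0 W0 G by (intro mult_mono) auto
      qed
      finally show ?thesis .
    next
      case False
      then have r1: "r \<ge> 1" by simp
      have heat: "norm x powr \<mu> * heat_mi_deriv s (\<lambda>_. 0) (x - y) \<le> 2 powr \<mu> * (K + 1) * W * G1"
      proof -
        define E where "E = s powr (- real CARD('d) / 2) * exp (- (norm (x - y))\<^sup>2 / (20 * s))"
        have EG: "E \<le> G1" unfolding E_def G1_def using s by (intro mult_left_mono) (auto simp: divide_left_mono)
        have heat_le_E: "heat_mi_deriv s (\<lambda>_. 0) (x - y) \<le> E"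
        proof -
          have "s \<le> 4 * pi * s" using s pi_gt3 by simp
          then have "(4 * pi * s) powr (- real CARD('d) / 2) \<le> s powr (- real CARD('d) / 2)"
            using s by (intro powr_mono2') auto
          moreover have "exp (- (norm (x - y))\<^sup>2 / (4 * s)) \<le> exp (- (norm (x - y))\<^sup>2 / (20 * s))"
            using s by (simp add: divide_left_mono)
          ultimately show ?thesis unfolding heat_mi_deriv_0[OF s] E_def by (intro mult_mono) auto
        qed
        have W1: "\<sigma> powr (\<mu> / 2) \<le> W"
          using ge_one_powr_ge_zero[OF r1 n0] mult_right_mono[of 1 "r powr n" "\<sigma> powr (\<mu> / 2)"] by (simp add: W_def)
        have 1: "norm (x - y) powr \<mu> * E \<le> K * W * G1"
        proof -
          have "norm (x - y) powr \<mu> * E = s powr (- real CARD('d) / 2) * (norm (x - y) powr \<mu> * exp (- (norm (x - y))\<^sup>2 / (20 * s)))"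
            by (simp add: E_def)
          also have "\<dots> \<le> s powr (- real CARD('d) / 2) * (K * s powr (\<mu> / 2) * exp (- (norm (x - y))\<^sup>2 / (40 * s)))"
            unfolding K_def using weighted_gauss_bound[OF s \<mu>(1)] by (intro mult_left_mono) auto
          also have "\<dots> = K * s powr (\<mu> / 2) * G1" by (simp add: G1_def)
          also have "\<dots> \<le> K * W * G1"
          proof -
            have "s powr (\<mu> / 2) \<le> \<sigma> powr (\<mu> / 2)" using \<sigma> s \<mu> by (intro powr_mono2) auto
            then show ?thesis using W1 K G by (intro mult_right_mono mult_left_mono) auto
          qed
          finally show ?thesis .
        qed
        \<comment> \<open>For large \<open>r\<close> the source point itself obeys
          \<open>norm y \<le> r * sqrt \<sigma>\<close>, and
          \<open>r powr \<mu> \<le> r powr n\<close> because \<open>\<mu> \<le> n\<close>.\<close>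
        have 2: "norm y powr \<mu> * E \<le> W * G1"
        proof -
          have "norm y \<le> r * sqrt \<sigma>" using \<sigma> norm_ge_zero[of y] by (simp add: r_def)
          then have "norm y powr \<mu> \<le> (r * sqrt \<sigma>) powr \<mu>" using \<mu> by (intro powr_mono2) auto
          also have "\<dots> = r powr \<mu> * \<sigma> powr (\<mu> / 2)"
            using r \<sigma> by (simp add: powr_mult powr_half_sqrt[symmetric] powr_powr)
          also have "\<dots> \<le> W" unfolding W_def using r1 \<mu> by (intro mult_right_mono powr_mono) auto
          finally have "norm y powr \<mu> \<le> W" .
          then show ?thesis using EG W0 by (intro mult_mono) (auto simp: E_def)
        qed
        have "norm x powr \<mu> * heat_mi_deriv s (\<lambda>_. 0) (x - y) \<le> (2 powr \<mu> * (norm (x - y) powr \<mu> + norm y powr \<mu>)) * E"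
          using powr_norm_le_split[OF \<mu>(1), of x y] heat_le_E heat_mi_deriv_0_pos[OF s, of "x - y"] by (intro mult_mono) auto
        also have "\<dots> = 2 powr \<mu> * (norm (x - y) powr \<mu> * E + norm y powr \<mu> * E)"
          by (simp add: algebra_simps)
        also have "\<dots> \<le> 2 powr \<mu> * (K * W * G1 + W * G1)"
          using 1 2 by (intro mult_left_mono add_mono) auto
        also have "\<dots> = 2 powr \<mu> * (K + 1) * W * G1" by (simp add: algebra_simps)
        finally show ?thesis .
      qed
      have terms: "norm x powr \<mu> * \<bar>hermite \<alpha> y * heat_mi_deriv \<sigma> \<alpha> x\<bar> \<le> K * W * G2" if "\<alpha> \<in> A" for \<alpha>
      proof -
        have k: "mi_order \<alpha> \<le> N" using that by (simp add: A_def)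
        have "(2 * (1 + norm y) / sqrt \<sigma>) ^ mi_order \<alpha> \<le> r ^ mi_order \<alpha>"
          using \<sigma> y0 unfolding r_def by (intro power_mono divide_right_mono) auto
        also have "\<dots> = r powr real (mi_order \<alpha>)" using r by (simp only: powr_realpow)
        also have "\<dots> \<le> r powr n" using r1 k N(1) by (intro powr_mono) auto
        finally have "\<bar>hermite \<alpha> y * heat_mi_deriv \<sigma> \<alpha> x\<bar> \<le> D * r powr n"
          using hermite_heat_mi_deriv_bound[OF \<sigma>(1), of \<alpha> y x] mult_left_mono[of _ "r powr n" D] by (fastforce simp: D_def)
        then have "norm x powr \<mu> * \<bar>hermite \<alpha> y * heat_mi_deriv \<sigma> \<alpha> x\<bar> \<le> norm x powr \<mu> * (D * r powr n)"
          by (intro mult_left_mono) auto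
        also have "\<dots> = (norm x powr \<mu> * D) * r powr n" by simp
        also have "\<dots> \<le> (K * \<sigma> powr (\<mu> / 2) * G2) * r powr n" using D by (intro mult_right_mono) auto
        finally show ?thesis by (simp add: W_def mult_ac)
      qed
      have "norm x powr \<mu> * \<bar>remainder_kernel N s x y\<bar>
         \<le> norm x powr \<mu> * (heat_mi_deriv s (\<lambda>_. 0) (x - y) + (\<Sum>\<alpha>\<in>A. \<bar>hermite \<alpha> y * heat_mi_deriv \<sigma> \<alpha> x\<bar>))"
      proof (intro mult_left_mono)
        show "\<bar>remainder_kernel N s x y\<bar> \<le> heat_mi_deriv s (\<lambda>_. 0) (x - y) + (\<Sum>\<alpha>\<in>A. \<bar>hermite \<alpha> y * heat_mi_deriv \<sigma> \<alpha> x\<bar>)"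
          using heat_mi_deriv_0_pos[OF s, of "x - y"] sum_abs[of "\<lambda>\<alpha>. hermite \<alpha> y * heat_mi_deriv \<sigma> \<alpha> x" A]
          unfolding remainder_kernel_def A_def \<sigma>_def by linarith
      qed simp
      also have "\<dots> = norm x powr \<mu> * heat_mi_deriv s (\<lambda>_. 0) (x - y) + (\<Sum>\<alpha>\<in>A. norm x powr \<mu> * \<bar>hermite \<alpha> y * heat_mi_deriv \<sigma> \<alpha> x\<bar>)"
        by (simp add: distrib_left sum_distrib_left)
      also have "\<dots> \<le> 2 powr \<mu> * (K + 1) * W * G1 + (\<Sum>\<alpha>\<in>A. K * W * G2)"
        using heat terms by (intro add_mono sum_mono) auto
      also have "\<dots> \<le> C * W * G1 + C * W * G2"
      proof (intro add_mono)
        show "2 powr \<mu> * (K + 1) * W * G1 \<le> C * W * G1"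
          using C1 W0 G by (intro mult_right_mono) auto
        have "(\<Sum>\<alpha>\<in>A. K * W * G2) = (real (card A) * K) * W * G2" by simp
        also have "real (card A) * K \<le> M * K" using K by (simp add: M_def mult_right_mono)
        then have "(real (card A) * K) * W * G2 \<le> C * W * G2"
          using C1(2) W0 G by (intro mult_right_mono) auto
        finally show "(\<Sum>\<alpha>\<in>A. K * W * G2) \<le> C * W * G2" .
      qed
      finally show ?thesis by (simp add: distrib_left)
    qed
    \<comment> \<open>The powers of \<open>\<sigma>\<close> in \<open>W\<close> combine to the
      exponent \<open>- (n - \<mu>) / 2\<close>, which is not positive, so \<open>\<sigma>\<close>
      may be replaced by the smaller \<open>s\<close>.\<close>
    have "W \<le> 4 powr n * (1 + norm y) powr n * s powr (- (n - \<mu>) / 2)"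
    proof -
      have "W = 4 powr n * (1 + norm y) powr n * (\<sigma> powr (- n / 2) * \<sigma> powr (\<mu> / 2))"
      proof -
        have "(4 * (1 + norm y)) powr n = 4 powr n * (1 + norm y) powr n"
          using y0 by (subst powr_mult) auto
        then show ?thesis using \<sigma> y0 unfolding W_def r_def
          by (subst powr_divide) (auto simp: powr_half_sqrt[symmetric] powr_powr powr_minus_divide)
      qed
      also have "\<sigma> powr (- n / 2) * \<sigma> powr (\<mu> / 2) = \<sigma> powr (- (n - \<mu>) / 2)"
        using \<sigma> by (simp add: powr_add[symmetric] field_simps)
      also have "\<dots> \<le> s powr (- (n - \<mu>) / 2)"
        using \<sigma> s \<mu> by (intro powr_mono2') auto
      finally show ?thesis by (simp add: mult_left_mono)
    qed
    then have "C * W * (G1 + G2) \<le> C * (4 powr n * (1 + norm y) powr n * s powr (- (n - \<mu>) / 2)) * (G1 + G2)"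
      using C0 G by (intro mult_right_mono mult_left_mono) auto
    then show ?thesis using key by (simp add: gauss_pair_def G1_def G2_def \<sigma>_def mult.assoc)
  qed
  then show ?thesis using C0 unfolding N_def by (intro exI[of _ "C * 4 powr n"]) auto
qed

section \<open>Integral estimates\<close>

lemma heat_deriv_0_shift: "heat_deriv s 0 (z - m) = normal_density m (sqrt (2 * s)) z"
  by (simp add: heat_deriv.simps normal_density_def)

lemma nn_integral_heat_mi_deriv_0:
  fixes y :: "real ^ 'd::finite"
  assumes s: "s > 0"
  shows "(\<integral>\<^sup>+x. ennreal (heat_mi_deriv s (\<lambda>_. 0) (x - y)) \<partial>lborel) = 1"
proof -
  have int: "integrable lborel (\<lambda>z. heat_deriv s 0 (z - y $ i))" "(LINT z|lborel. heat_deriv s 0 (z - y $ i)) = 1" for i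
    using s by (simp_all add: heat_deriv_0_shift)
  have "integrable lborel (\<lambda>x. heat_mi_deriv s (\<lambda>_. 0) (x - y))" "(LINT x|lborel. heat_mi_deriv s (\<lambda>_. 0) (x - y)) = 1"
    using lborel_integral_prod_vec[of "\<lambda>i z. heat_deriv s 0 (z - y $ i)"] int by (simp_all add: heat_mi_deriv_def)
  then show ?thesis
    using heat_mi_deriv_0_pos[OF s] by (subst nn_integral_eq_integral) (auto intro!: AE_I2 less_imp_le)
qed

text \<open>Because \<open>4 * (10 * s) = 40 * s\<close>, the Gaussians of \<open>gauss_pair\<close>
  are multiples of heat kernels at ten times the time, whose total mass is 1.\<close>

lemma scaled_heat_mi_deriv_0:
  fixes x :: "real ^ 'd::finite"
  assumes "s > 0"
  shows "(40 * pi) powr (real CARD('d) / 2) * heat_mi_deriv (10 * s) (\<lambda>_. 0) x = s powr (- real CARD('d) / 2) * exp (- (norm x)\<^sup>2 / (40 * s))"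
proof -
  have "(4 * pi * (10 * s)) powr (- real CARD('d) / 2) = (40 * pi) powr (- real CARD('d) / 2) * s powr (- real CARD('d) / 2)"
    using assms by (subst powr_mult[symmetric]) (auto simp: mult_ac)
  then show ?thesis using assms by (simp add: heat_mi_deriv_0 powr_minus field_simps)
qed

lemma gauss_pair_eq:
  fixes x :: "real ^ 'd::finite"
  assumes "s > 0"
  shows "gauss_pair s x y = (40 * pi) powr (real CARD('d) / 2) * (heat_mi_deriv (10 * s) (\<lambda>_. 0) (x - y) + heat_mi_deriv (10 * (s + 1)) (\<lambda>_. 0) (x - 0))"
  using scaled_heat_mi_deriv_0[of s "x - y"] scaled_heat_mi_deriv_0[of "s + 1" x] assms
  by (simp only: distrib_left gauss_pair_def diff_zero)

text \<open>The mass depends neither on \<open>s\<close> nor on \<open>y\<close>; this is the source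
  of the estimate for \<open>p = 1\<close>.\<close>

lemma nn_integral_gauss_pair:
  fixes y :: "real ^ 'd::finite"
  assumes s: "s > 0"
  shows "(\<integral>\<^sup>+x. ennreal (gauss_pair s x y) \<partial>lborel) = ennreal (2 * (40 * pi) powr (real CARD('d) / 2))"
proof -
  have [measurable]: "heat_mi_deriv (10 * s) (\<lambda>_ :: 'd. 0) \<in> borel_measurable borel" "heat_mi_deriv (10 * (s + 1)) (\<lambda>_ :: 'd. 0) \<in> borel_measurable borel"
    using s by (auto intro: borel_measurable_heat_mi_deriv)
  have pos: "heat_mi_deriv (10 * s) (\<lambda>_. 0) x \<ge> 0" "heat_mi_deriv (10 * (s + 1)) (\<lambda>_. 0) x \<ge> 0" for x :: "real ^ 'd"
    using s heat_mi_deriv_0_pos[of "10 * s" x] heat_mi_deriv_0_pos[of "10 * (s + 1)" x] by (auto simp: less_imp_le)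
  have "(\<integral>\<^sup>+x. ennreal (gauss_pair s x y) \<partial>lborel) =
      (\<integral>\<^sup>+x. ennreal ((40 * pi) powr (real CARD('d) / 2)) * (ennreal (heat_mi_deriv (10 * s) (\<lambda>_. 0) (x - y)) + ennreal (heat_mi_deriv (10 * (s + 1)) (\<lambda>_. 0) (x - 0))) \<partial>lborel)"
    unfolding gauss_pair_eq[OF s] using pos by (simp add: ennreal_mult)
  also have "\<dots> = ennreal ((40 * pi) powr (real CARD('d) / 2)) * (1 + 1)"
    using nn_integral_heat_mi_deriv_0[of "10 * s" y] nn_integral_heat_mi_deriv_0[of "10 * (s + 1)" "0 :: real ^ 'd"] s
    by (simp add: nn_integral_cmult nn_integral_add)
  also have "\<dots> = ennreal (2 * (40 * pi) powr (real CARD('d) / 2))"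
    by (simp add: ennreal_mult mult.commute)
  finally show ?thesis .
qed

lemma gauss_pair_nonneg: "gauss_pair s x y \<ge> 0"
  by (simp add: gauss_pair_def)

text \<open>The source of the estimate for \<open>p = \<infinity>\<close>: the second Gaussian has
  the smaller height, since \<open>s + 1 \<ge> s\<close> and the exponent is negative.\<close>

lemma gauss_pair_le:
  fixes x :: "real ^ 'd::finite"
  assumes s: "s > 0"
  shows "gauss_pair s x y \<le> 2 * s powr (- real CARD('d) / 2)"
proof -
  have "s powr (- real CARD('d) / 2) * exp (- (norm (x - y))\<^sup>2 / (40 * s)) \<le> s powr (- real CARD('d) / 2) * 1"
    using s by (intro mult_left_mono) auto
  moreover have "(s + 1) powr (- real CARD('d) / 2) * exp (- (norm x)\<^sup>2 / (40 * (s + 1))) \<le> s powr (- real CARD('d) / 2) * 1"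
    using s by (intro mult_mono powr_mono2') auto
  ultimately show ?thesis by (simp add: gauss_pair_def)
qed

section \<open>Measurability and Borel representatives\<close>

lemma borel_measurable_gauss_pair [measurable]:
  "case_prod (gauss_pair s) \<in> borel_measurable (borel \<Otimes>\<^sub>M borel)"
  unfolding gauss_pair_def split_beta' by measurable

lemma borel_measurable_remainder_kernel:
  assumes s: "s > 0"
  shows "case_prod (remainder_kernel N s) \<in> borel_measurable (borel \<Otimes>\<^sub>M borel)"
proof -
  have [measurable]: "heat_mi_deriv s \<alpha> \<in> borel_measurable borel" "heat_mi_deriv (s + 1) \<alpha> \<in> borel_measurable borel" for \<alpha> :: "'a \<Rightarrow> nat"
    using s by (auto intro: borel_measurable_heat_mi_deriv)
  show ?thesis unfolding remainder_kernel_def split_beta' by measurable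
qed

text \<open>Elements of \<open>L1_space\<close> are only Lebesgue measurable. A Borel function
  \<open>v\<close> equal to \<open>u\<close> almost everywhere makes Fubini on \<open>lborel\<close>
  available. Finiteness of the norm yields measurability of the weighted function, and dividing by
  the positive weight that of \<open>u\<close>.\<close>

lemma L1_spaceD:
  fixes u :: "real ^ 'd::finite \<Rightarrow> real"
  assumes u: "u \<in> L1_space n"
  obtains v where "v \<in> borel_measurable borel" "u \<in> borel_measurable lebesgue"
    "AE x in lebesgue. u x = v x" "integrable lborel (\<lambda>x. (1 + norm x) powr n * \<bar>v x\<bar>)"
    "L1_norm n u = ennreal (LINT x|lborel. (1 + norm x) powr n * \<bar>v x\<bar>)"
proof -
  define g where "g x = (1 + norm x) powr n * u x" for x
  define I where "I = (\<integral>\<^sup>+x. ennreal \<bar>g x\<bar> \<partial>lebesgue)"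
  have w: "(1 + norm x) powr n > 0" for x :: "real ^ 'd"
    using norm_ge_zero[of x] by (auto simp: add_nonneg_eq_0_iff)
  have fin: "Lp_norm 1 g < \<infinity>" using u by (simp add: L1_space_def L1_norm_def g_def[abs_def])
  then have gm: "g \<in> borel_measurable lebesgue" by (auto simp: Lp_norm_def split: if_splits)
  have Lp: "Lp_norm 1 g = I"
    using gm by (auto simp: Lp_norm_def I_def Let_def powr_one less_top[symmetric])
  have wm: "(\<lambda>x :: real ^ 'd. (1 + norm x) powr n) \<in> borel_measurable lebesgue"
    by (intro measurable_completion) measurable
  have "(\<lambda>x. g x / (1 + norm x) powr n) \<in> borel_measurable lebesgue"
    using gm wm by measurable
  moreover have "(\<lambda>x. g x / (1 + norm x) powr n) = u"
    using w by (auto simp: g_def fun_eq_iff less_imp_neq[symmetric])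
  ultimately have um: "u \<in> borel_measurable lebesgue" by simp
  from completion_ex_borel_measurable_real[OF this]
  obtain v where v: "v \<in> borel_measurable lborel" "AE x in lborel. u x = v x" by blast
  have [measurable]: "v \<in> borel_measurable borel" using v(1) by simp
  have AE: "AE x in lebesgue. u x = v x" using v(2) by (rule AE_completion)
  have "I = (\<integral>\<^sup>+x. ennreal ((1 + norm x) powr n * \<bar>v x\<bar>) \<partial>lebesgue)"
    unfolding I_def g_def using AE by (intro nn_integral_cong_AE) (auto simp: abs_mult elim!: eventually_mono)
  also have "\<dots> = (\<integral>\<^sup>+x. ennreal ((1 + norm x) powr n * \<bar>v x\<bar>) \<partial>lborel)"
    by (simp add: nn_integral_completion)
  finally have I: "I = (\<integral>\<^sup>+x. ennreal ((1 + norm x) powr n * \<bar>v x\<bar>) \<partial>lborel)" .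
  have int: "integrable lborel (\<lambda>x. (1 + norm x) powr n * \<bar>v x\<bar>)"
    using fin unfolding Lp I by (intro integrableI_nonneg) auto
  have "L1_norm n u = ennreal (LINT x|lborel. (1 + norm x) powr n * \<bar>v x\<bar>)"
    using nn_integral_eq_integral[OF int] Lp I by (simp add: L1_norm_def g_def[abs_def])
  then show ?thesis using that[of v] um AE int by simp
qed

lemma integral_lebesgue_cong_borel:
  fixes f u v :: "'a::euclidean_space \<Rightarrow> real"
  assumes "f \<in> borel_measurable borel" "v \<in> borel_measurable borel" "u \<in> borel_measurable lebesgue"
    "AE x in lebesgue. u x = v x"
  shows "(LINT x|lebesgue. f x * u x) = (LINT x|lborel. f x * v x)"
proof -
  have [measurable]: "f \<in> borel_measurable lborel" "v \<in> borel_measurable lborel" using assms by auto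
  have fm: "f \<in> borel_measurable lebesgue" "v \<in> borel_measurable lebesgue"
    by (auto intro: measurable_completion)
  have "(LINT x|lebesgue. f x * u x) = (LINT x|lebesgue. f x * v x)"
    using assms(3,4) fm by (intro integral_cong_AE) (auto elim!: eventually_mono)
  also have "\<dots> = (LINT x|lborel. f x * v x)"
    by (intro integral_completion) measurable
  finally show ?thesis .
qed

text \<open>Integrate \<open>\<bar>g\<bar>^p \<le> (sup \<bar>g\<bar>)^(p - 1) *
  \<bar>g\<bar>\<close>. Both hypotheses share the constant \<open>M\<close>, so only the ratio
  \<open>b\<close> of the two bounds acquires an exponent depending on \<open>p\<close>.\<close>

lemma Lp_norm_le_interpolated:
  fixes g :: "real ^ 'd::finite \<Rightarrow> real"
  assumes gm: "g \<in> borel_measurable borel" and b: "b > 0" and M: "M \<ge> 0"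
    and sup: "\<And>x. \<bar>g x\<bar> \<le> M * b" and one: "(\<integral>\<^sup>+x. ennreal \<bar>g x\<bar> \<partial>lborel) \<le> ennreal M"
    and p: "1 \<le> p"
  shows "Lp_norm p g \<le> ennreal (M * b powr (1 - enn2real (1 / p)))"
proof -
  have gl: "g \<in> borel_measurable lebesgue" using gm by (intro measurable_completion) simp
  show ?thesis
  proof (cases "p = \<infinity>")
    case True
    \<comment> \<open>In \<open>ennreal\<close>, \<open>1 / \<infinity> = 0\<close>, so the exponent
      of \<open>b\<close> is 1 and the claim is the supremum bound.\<close>
    have "esssup lebesgue (\<lambda>x. ennreal \<bar>g x\<bar>) \<le> ennreal (M * b)"
      using gl sup by (intro esssup_I) (auto intro!: AE_I2 ennreal_leI)
    then show ?thesis using True gl b by (simp add: Lp_norm_def)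
  next
    case False
    define r where "r = enn2real p"
    have pr: "p = ennreal r" using False by (simp add: r_def less_top)
    have r: "r \<ge> 1" using p pr by (metis ennreal_1 ennreal_le_iff2 not_one_le_zero ennreal_neg linorder_le_cases order_trans)
    have q: "enn2real (1 / p) = 1 / r"
      using r by (simp add: pr ennreal_1[symmetric] divide_ennreal del: ennreal_1)
    have ptw: "\<bar>g x\<bar> powr r \<le> (M * b) powr (r - 1) * \<bar>g x\<bar>" for x
    proof (cases "g x = 0")
      case False
      have "\<bar>g x\<bar> powr r = \<bar>g x\<bar> powr (r - 1) * \<bar>g x\<bar>"
        using False by (simp add: powr_diff)
      also have "\<dots> \<le> (M * b) powr (r - 1) * \<bar>g x\<bar>"
        using sup[of x] r by (intro mult_right_mono powr_mono2) auto
      finally show ?thesis .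
    qed simp
    define I where "I = (\<integral>\<^sup>+x. ennreal (\<bar>g x\<bar> powr r) \<partial>lebesgue)"
    have Mb: "(M * b) powr (r - 1) * M = (M * b powr (1 - 1 / r)) powr r"
    proof (cases "M = 0")
      case False
      then have "M > 0" using M by simp
      then have "(M * b) powr (r - 1) * M = M powr r * b powr (r - 1)"
        using b by (simp add: powr_mult powr_diff)
      also have "b powr (r - 1) = (b powr (1 - 1 / r)) powr r"
        using r by (simp add: powr_powr left_diff_distrib)
      finally show ?thesis using b M by (simp add: powr_mult)
    qed simp
    have "I = (\<integral>\<^sup>+x. ennreal (\<bar>g x\<bar> powr r) \<partial>lborel)" unfolding I_def by (simp add: nn_integral_completion)
    also have "\<dots> \<le> (\<integral>\<^sup>+x. ennreal ((M * b) powr (r - 1)) * ennreal \<bar>g x\<bar> \<partial>lborel)"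
      using ptw by (intro nn_integral_mono) (simp add: ennreal_mult[symmetric] ennreal_leI)
    also have "\<dots> = ennreal ((M * b) powr (r - 1)) * (\<integral>\<^sup>+x. ennreal \<bar>g x\<bar> \<partial>lborel)"
      using gm by (intro nn_integral_cmult) auto
    also have "\<dots> \<le> ennreal ((M * b) powr (r - 1)) * ennreal M" using one by (rule mult_left_mono) simp
    also have "\<dots> = ennreal ((M * b powr (1 - 1 / r)) powr r)"
      using M by (simp add: ennreal_mult[symmetric] Mb)
    finally have I: "I \<le> ennreal ((M * b powr (1 - 1 / r)) powr r)" .
    \<comment> \<open>Finiteness selects the branch of \<open>Lp_norm\<close> in which the root is
      taken in \<open>real\<close>.\<close>
    then have fin: "I \<noteq> \<infinity>" by (metis ennreal_neq_top infinity_ennreal_def top.extremum_uniqueI)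
    have "enn2real I \<le> (M * b powr (1 - 1 / r)) powr r"
      using enn2real_mono[OF I] by simp
    then have "enn2real I powr (1 / r) \<le> ((M * b powr (1 - 1 / r)) powr r) powr (1 / r)"
      using r by (intro powr_mono2) auto
    also have "\<dots> = M * b powr (1 - 1 / r)"
      using r M by (simp add: powr_powr)
    finally show ?thesis
      using fin gl False by (simp add: Lp_norm_def Let_def r_def[symmetric] I_def[symmetric] q ennreal_leI)
  qed
qed

text \<open>Linearity of the integral. Each Hermite polynomial of order at most \<open>n\<close> is
  dominated by a multiple of the weight \<open>(1 + norm y) powr n\<close>, and the bounded heat
  kernel by a constant times that weight, so all integrals converge separately.\<close>

lemma remainder_representation:
  fixes u v :: "real ^ 'd::finite \<Rightarrow> real"
  assumes n: "n \<ge> 0" and st: "\<nu> * t > 0"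
    and v: "v \<in> borel_measurable borel" "u \<in> borel_measurable lebesgue"
    "AE x in lebesgue. u x = v x" "integrable lborel (\<lambda>x. (1 + norm x) powr n * \<bar>v x\<bar>)"
  shows "conv (heat_kernel \<nu> t) u x - (\<Sum>\<alpha> | mi_order \<alpha> \<le> nat \<lfloor>n\<rfloor>.
      pairing (hermite \<alpha>) u * conv (mi_deriv \<alpha> (heat_kernel \<nu> t)) phi0 x)
    = (LINT y|lborel. remainder_kernel (nat \<lfloor>n\<rfloor>) (\<nu> * t) x y * v y)"
proof -
  define s where "s = \<nu> * t"
  have s: "s > 0" using st by (simp add: s_def)
  note [measurable] = v(1) borel_measurable_heat_mi_deriv[OF s]
  have w1: "1 \<le> (1 + norm y) powr n" for y :: "real ^ 'd" using n by (intro ge_one_powr_ge_zero) auto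
  have herm: "integrable lborel (\<lambda>y. hermite \<alpha> y * v y)" if k: "mi_order \<alpha> \<le> nat \<lfloor>n\<rfloor>" for \<alpha> :: "'d \<Rightarrow> nat"
  proof -
    obtain C where C: "C \<ge> 0" "\<And>y :: real ^ 'd. \<bar>hermite \<alpha> y\<bar> \<le> C * (1 + norm y) ^ mi_order \<alpha>"
      using hermite_bound by blast
    have "real (mi_order \<alpha>) \<le> n" using k n by linarith
    have "\<bar>hermite \<alpha> y * v y\<bar> \<le> C * ((1 + norm y) powr n * \<bar>v y\<bar>)" for y
    proof -
      have y0: "1 + norm y > 0" using norm_ge_zero[of y] by linarith
      have "(1 + norm y) ^ mi_order \<alpha> = (1 + norm y) powr real (mi_order \<alpha>)"
        using y0 by (simp only: powr_realpow)
      also have "\<dots> \<le> (1 + norm y) powr n" using \<open>real (mi_order \<alpha>) \<le> n\<close> by (intro powr_mono) auto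
      finally have "C * (1 + norm y) ^ mi_order \<alpha> \<le> C * (1 + norm y) powr n" using C(1) by (rule mult_left_mono)
      with C(2)[of y] have "\<bar>hermite \<alpha> y\<bar> \<le> C * (1 + norm y) powr n" by linarith
      then have "\<bar>hermite \<alpha> y\<bar> * \<bar>v y\<bar> \<le> C * (1 + norm y) powr n * \<bar>v y\<bar>" by (rule mult_right_mono) simp
      then show ?thesis by (simp add: abs_mult mult.assoc)
    qed
    then show ?thesis using C(1)
      by (intro Bochner_Integration.integrable_bound[OF integrable_mult_right[OF v(4), of C]])
        (auto intro!: AE_I2)
  qed
  have heat: "integrable lborel (\<lambda>y. heat_mi_deriv s (\<lambda>_. 0) (x - y) * v y)"
  proof -
    let ?c = "(4 * pi * s) powr (- real CARD('d) / 2)"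
    have "\<bar>heat_mi_deriv s (\<lambda>_. 0) (x - y) * v y\<bar> \<le> ?c * ((1 + norm y) powr n * \<bar>v y\<bar>)" for y
    proof -
      have "\<bar>heat_mi_deriv s (\<lambda>_. 0) (x - y)\<bar> \<le> ?c * 1"
        using s unfolding heat_mi_deriv_0[OF s] abs_mult by (intro mult_mono) auto
      moreover have "\<bar>v y\<bar> \<le> (1 + norm y) powr n * \<bar>v y\<bar>"
        using mult_right_mono[OF w1[of y], of "\<bar>v y\<bar>"] by simp
      ultimately show ?thesis unfolding abs_mult by (intro mult_mono) auto
    qed
    then show ?thesis
      by (intro Bochner_Integration.integrable_bound[OF integrable_mult_right[OF v(4), of ?c]])
        (auto intro!: AE_I2)
  qed
  have "conv (heat_kernel \<nu> t) u x = (LINT y|lborel. heat_mi_deriv s (\<lambda>_. 0) (x - y) * v y)"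
    unfolding conv_def heat_kernel_eq[OF st] s_def[symmetric]
    by (rule integral_lebesgue_cong_borel[OF _ v(1-3)]) measurable
  moreover have "pairing (hermite \<alpha>) u = (LINT y|lborel. hermite \<alpha> y * v y)" for \<alpha>
    unfolding pairing_def by (rule integral_lebesgue_cong_borel[OF _ v(1-3)]) measurable
  moreover have "(LINT y|lborel. remainder_kernel (nat \<lfloor>n\<rfloor>) s x y * v y) =
     (LINT y|lborel. heat_mi_deriv s (\<lambda>_. 0) (x - y) * v y - (\<Sum>\<alpha> | mi_order \<alpha> \<le> nat \<lfloor>n\<rfloor>. hermite \<alpha> y * v y * heat_mi_deriv (s + 1) \<alpha> x))"
    by (intro Bochner_Integration.integral_cong refl)
      (simp add: remainder_kernel_def left_diff_distrib sum_distrib_right mult.assoc mult.commute[of "v _"])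
  moreover have "\<dots> = (LINT y|lborel. heat_mi_deriv s (\<lambda>_. 0) (x - y) * v y)
      - (\<Sum>\<alpha> | mi_order \<alpha> \<le> nat \<lfloor>n\<rfloor>. (LINT y|lborel. hermite \<alpha> y * v y) * heat_mi_deriv (s + 1) \<alpha> x)"
    using heat herm by (subst Bochner_Integration.integral_diff) (auto intro!: Bochner_Integration.integrable_sum simp: Bochner_Integration.integral_sum)
  ultimately show ?thesis
    by (simp add: conv_mi_deriv_heat_kernel_phi0[OF st] s_def)
qed

text \<open>The weighted remainder is dominated by a multiple of \<open>Q\<close>, the integral of
  \<open>gauss_pair\<close> against the weighted data. The height of \<open>gauss_pair\<close>
  bounds \<open>Q\<close> uniformly and its mass bounds the integral of \<open>Q\<close>, after
  which \<open>Lp_norm_le_interpolated\<close> applies.\<close>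

lemma weighted_remainder_Lp_bound:
  fixes v R :: "real ^ 'd::finite \<Rightarrow> real"
  assumes \<mu>: "0 \<le> \<mu>" "\<mu> \<le> n" and p: "1 \<le> p" and s: "s > 0" and C: "C \<ge> 0"
    and ker: "\<And>x y :: real ^ 'd. norm x powr \<mu> * \<bar>remainder_kernel N s x y\<bar>
      \<le> C * (1 + norm y) powr n * s powr (- (n - \<mu>) / 2) * gauss_pair s x y"
    and v: "v \<in> borel_measurable borel" "integrable lborel (\<lambda>x. (1 + norm x) powr n * \<bar>v x\<bar>)"
    and R: "\<And>x. R x = (LINT y|lborel. remainder_kernel N s x y * v y)"
  shows "hom_Lp_norm p \<mu> R \<le> ennreal (C * (2 + 2 * (40 * pi) powr (real CARD('d) / 2))
     * (LINT x|lborel. (1 + norm x) powr n * \<bar>v x\<bar>)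
     * s powr (- (real CARD('d) / 2) * (1 - enn2real (1 / p)) - (n - \<mu>) / 2))"
proof -
  define m where "m y = (1 + norm y) powr n * \<bar>v y\<bar>" for y
  define A where "A = (LINT y|lborel. m y)"
  define L where "L = 2 * (40 * pi) powr (real CARD('d) / 2)"
  define e where "e = s powr (- (n - \<mu>) / 2)"
  define b where "b = s powr (- real CARD('d) / 2)"
  \<comment> \<open>One constant for both endpoints: the 2 comes from \<open>gauss_pair_le\<close>,
    and \<open>L\<close> is the mass of \<open>gauss_pair\<close>.\<close>
  define M where "M = C * (2 + L) * A * e"
  have m0: "m y \<ge> 0" for y by (simp add: m_def)
  have A0: "A \<ge> 0" unfolding A_def using m0 by simp
  have nn: "e \<ge> 0" "L \<ge> 0" "M \<ge> 0" using A0 C by (simp_all add: e_def L_def M_def)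
  have b: "b > 0" using s by (simp add: b_def)
  have mint: "integrable lborel m" using v(2) by (simp add: m_def[abs_def])
  note [measurable] = v(1) borel_measurable_remainder_kernel[OF s]
  have [measurable]: "m \<in> borel_measurable borel" unfolding m_def[abs_def] by measurable
  have Gint: "integrable lborel (\<lambda>y. gauss_pair s x y * m y)" for x
  proof (rule Bochner_Integration.integrable_bound[OF integrable_mult_right[OF mint, of "2 * b"]])
    show "AE y in lborel. norm (gauss_pair s x y * m y) \<le> norm (2 * b * m y)"
      using gauss_pair_le[OF s, of x] gauss_pair_nonneg[of s x] m0 b
      by (intro AE_I2) (auto simp: abs_mult b_def intro!: mult_right_mono)
  qed measurable
  define Q where "Q x = (LINT y|lborel. gauss_pair s x y * m y)" for x
  have g: "\<bar>norm x powr \<mu> * R x\<bar> \<le> C * e * Q x" for x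
  proof -
    have "\<bar>norm x powr \<mu> * R x\<bar> = \<bar>LINT y|lborel. norm x powr \<mu> * (remainder_kernel N s x y * v y)\<bar>"
      by (simp add: R)
    also have "\<dots> \<le> (LINT y|lborel. C * e * (gauss_pair s x y * m y))"
    proof -
      have le: "\<bar>norm x powr \<mu> * (remainder_kernel N s x y * v y)\<bar> \<le> C * e * (gauss_pair s x y * m y)" for y
      proof -
        have "norm x powr \<mu> * \<bar>remainder_kernel N s x y\<bar> * \<bar>v y\<bar> \<le>
            C * (1 + norm y) powr n * e * gauss_pair s x y * \<bar>v y\<bar>"
          using ker[of x y] by (intro mult_right_mono) (auto simp: e_def)
        then show "\<bar>norm x powr \<mu> * (remainder_kernel N s x y * v y)\<bar> \<le> C * e * (gauss_pair s x y * m y)"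
          by (simp add: abs_mult m_def mult_ac)
      qed
      have ig: "integrable lborel (\<lambda>y. C * e * (gauss_pair s x y * m y))" using Gint by simp
      have "integrable lborel (\<lambda>y. norm x powr \<mu> * (remainder_kernel N s x y * v y))"
      proof (rule Bochner_Integration.integrable_bound[OF ig])
        show "AE y in lborel. norm (norm x powr \<mu> * (remainder_kernel N s x y * v y))
            \<le> norm (C * e * (gauss_pair s x y * m y))"
          using le order_trans[OF le abs_ge_self] by (intro AE_I2) simp
      qed measurable
      then show ?thesis
        using Bochner_Integration.integral_norm_bound_integral[OF _ ig, of "\<lambda>y. norm x powr \<mu> * (remainder_kernel N s x y * v y)"] le by simp
    qed
    also have "\<dots> = C * e * Q x" by (simp add: Q_def)
    finally show ?thesis .
  qed
  have Qle: "Q x \<le> 2 * b * A" for x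
  proof -
    have "Q x \<le> (LINT y|lborel. 2 * b * m y)"
      unfolding Q_def using gauss_pair_le[OF s, of x] m0 Gint mint
      by (intro integral_mono) (auto simp: b_def intro!: mult_right_mono)
    then show ?thesis by (simp add: A_def)
  qed
  have "(\<integral>\<^sup>+x. ennreal (Q x) \<partial>lborel) = (\<integral>\<^sup>+x. (\<integral>\<^sup>+y. ennreal (gauss_pair s x y * m y) \<partial>lborel) \<partial>lborel)"
    unfolding Q_def using Gint m0 gauss_pair_nonneg
    by (intro nn_integral_cong) (subst nn_integral_eq_integral, auto intro!: AE_I2 mult_nonneg_nonneg)
  \<comment> \<open>Tonelli: integrating over \<open>x\<close> first uses that the mass of
    \<open>gauss_pair\<close> is the same for every \<open>y\<close>.\<close>
  also have "\<dots> = (\<integral>\<^sup>+y. (\<integral>\<^sup>+x. ennreal (gauss_pair s x y * m y) \<partial>lborel) \<partial>lborel)"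
    by (rule lborel_pair.Fubini') measurable
  also have "\<dots> = (\<integral>\<^sup>+y. ennreal L * ennreal (m y) \<partial>lborel)"
  proof (rule nn_integral_cong)
    fix y
    have "(\<integral>\<^sup>+x. ennreal (gauss_pair s x y * m y) \<partial>lborel) = (\<integral>\<^sup>+x. ennreal (gauss_pair s x y) \<partial>lborel) * ennreal (m y)"
      by (subst nn_integral_multc[symmetric]) (auto simp: ennreal_mult m0 gauss_pair_nonneg)
    then show "(\<integral>\<^sup>+x. ennreal (gauss_pair s x y * m y) \<partial>lborel) = ennreal L * ennreal (m y)"
      by (simp add: nn_integral_gauss_pair[OF s] L_def)
  qed
  also have "\<dots> = ennreal L * ennreal A"
    using nn_integral_eq_integral[OF mint] m0 by (simp add: nn_integral_cmult A_def)
  finally have Qint: "(\<integral>\<^sup>+x. ennreal (Q x) \<partial>lborel) = ennreal (L * A)"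
    using nn A0 by (simp add: ennreal_mult)
  have Qm [measurable]: "Q \<in> borel_measurable borel" unfolding Q_def[abs_def] by measurable
  have Rm: "R \<in> borel_measurable borel" unfolding R[abs_def] by measurable
  have "Lp_norm p (\<lambda>x. norm x powr \<mu> * R x) \<le> ennreal (M * b powr (1 - enn2real (1 / p)))"
  proof (rule Lp_norm_le_interpolated[OF _ b nn(3) _ _ p])
    show "(\<lambda>x. norm x powr \<mu> * R x) \<in> borel_measurable borel" using Rm by measurable
    show "\<bar>norm x powr \<mu> * R x\<bar> \<le> M * b" for x
    proof -
      have "C * e * Q x \<le> C * e * (2 * b * A)" using Qle C nn by (intro mult_left_mono) auto
      also have "\<dots> = C * 2 * A * e * b" by simp
      also have "\<dots> \<le> M * b" unfolding M_def using C nn A0 b by (intro mult_right_mono mult_left_mono) auto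
      finally show ?thesis using g[of x] by linarith
    qed
    have "(\<integral>\<^sup>+x. ennreal \<bar>norm x powr \<mu> * R x\<bar> \<partial>lborel) \<le> (\<integral>\<^sup>+x. ennreal (C * e) * ennreal (Q x) \<partial>lborel)"
      using g C nn by (intro nn_integral_mono) (simp add: ennreal_mult'[symmetric] ennreal_leI)
    also have "\<dots> = ennreal (C * e * (L * A))"
      using C nn A0 by (simp add: nn_integral_cmult Qint ennreal_mult)
    also have "\<dots> \<le> ennreal M"
    proof (rule ennreal_leI)
      have "C * e * (L * A) = C * L * A * e" by simp
      also have "\<dots> \<le> M" unfolding M_def using C nn A0 by (intro mult_right_mono mult_left_mono) auto
      finally show "C * e * (L * A) \<le> M" .
    qed
    finally show "(\<integral>\<^sup>+x. ennreal \<bar>norm x powr \<mu> * R x\<bar> \<partial>lborel) \<le> ennreal M" .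
  qed
  moreover have "e * b powr (1 - enn2real (1 / p)) =
      s powr (- (real CARD('d) / 2) * (1 - enn2real (1 / p)) - (n - \<mu>) / 2)"
    using s unfolding e_def b_def powr_powr powr_add[symmetric]
    by (intro arg_cong[of _ _ "\<lambda>z. s powr z"]) (simp add: field_simps)
  then have "M * b powr (1 - enn2real (1 / p)) = C * (2 + L) * A *
      s powr (- (real CARD('d) / 2) * (1 - enn2real (1 / p)) - (n - \<mu>) / 2)"
    unfolding M_def by (simp only: mult.assoc)
  ultimately show ?thesis
    by (simp add: hom_Lp_norm_def A_def m_def L_def)
qed

theorem proposition2p6:
  fixes \<nu> n :: real
  assumes "\<nu> > 0" and "n \<ge> 0"
  shows "\<exists>R :: (real ^ 'd::finite \<Rightarrow> real) \<Rightarrow> real \<Rightarrow> real ^ 'd \<Rightarrow> real.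
    (\<forall>u0 \<in> L1_space n. \<forall>u. (\<forall>t>0. u t = conv (heat_kernel \<nu> t) u0) \<longrightarrow>
       (\<forall>t>0. \<forall>x. u t x =
          (\<Sum>\<alpha> | mi_order \<alpha> \<le> nat \<lfloor>n\<rfloor>.
             pairing (hermite \<alpha>) u0 * conv (mi_deriv \<alpha> (heat_kernel \<nu> t)) phi0 x)
          + R u0 t x)) \<and>
    (\<forall>\<mu> p. 0 \<le> \<mu> \<and> \<mu> \<le> n \<and> 1 \<le> p \<longrightarrow>
       (\<exists>C\<ge>0. \<forall>u0 \<in> L1_space n. \<forall>t>0.
          hom_Lp_norm p \<mu> (R u0 t) \<le>
            ennreal C * L1_norm n u0 *
            ennreal ((\<nu> * t) powr (- (real CARD('d) / 2) * (1 - enn2real (1 / p)) - (n - \<mu>) / 2))))"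
proof -
  \<comment> \<open>Defining the remainder as the difference makes the expansion immediate, and the
    same \<open>R\<close> serves all \<open>\<mu>\<close> and \<open>p\<close>.\<close>
  define R :: "(real ^ 'd \<Rightarrow> real) \<Rightarrow> real \<Rightarrow> real ^ 'd \<Rightarrow> real" where
    "R u0 t x = conv (heat_kernel \<nu> t) u0 x - (\<Sum>\<alpha> | mi_order \<alpha> \<le> nat \<lfloor>n\<rfloor>.
             pairing (hermite \<alpha>) u0 * conv (mi_deriv \<alpha> (heat_kernel \<nu> t)) phi0 x)" for u0 t x
  have "\<exists>C\<ge>0. \<forall>u0 \<in> L1_space n. \<forall>t>0.
          hom_Lp_norm p \<mu> (R u0 t) \<le> ennreal C * L1_norm n u0 *
            ennreal ((\<nu> * t) powr (- (real CARD('d) / 2) * (1 - enn2real (1 / p)) - (n - \<mu>) / 2))"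
    if \<mu>: "0 \<le> \<mu>" "\<mu> \<le> n" and p: "1 \<le> p" for \<mu> p
  proof -
    obtain C where C: "C \<ge> 0" "\<And>s (x :: real ^ 'd) y. s > 0 \<Longrightarrow>
        norm x powr \<mu> * \<bar>remainder_kernel (nat \<lfloor>n\<rfloor>) s x y\<bar>
        \<le> C * (1 + norm y) powr n * s powr (- (n - \<mu>) / 2) * gauss_pair s x y"
      using remainder_kernel_bound[OF \<mu>] by blast
    \<comment> \<open>The kernel bound is uniform in \<open>s = \<nu> * t\<close>, so this constant
      depends neither on \<open>u0\<close> nor on \<open>t\<close>.\<close>
    let ?K = "C * (2 + 2 * (40 * pi) powr (real CARD('d) / 2))"
    have K0: "?K \<ge> 0" using C(1) by simp
    have "hom_Lp_norm p \<mu> (R u0 t) \<le> ennreal ?K * L1_norm n u0 *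
            ennreal ((\<nu> * t) powr (- (real CARD('d) / 2) * (1 - enn2real (1 / p)) - (n - \<mu>) / 2))"
      if u0: "u0 \<in> L1_space n" and t: "t > 0" for u0 t
    proof -
      have st: "\<nu> * t > 0" using assms(1) t by simp
      from L1_spaceD[OF u0] obtain v where v: "v \<in> borel_measurable borel" "u0 \<in> borel_measurable lebesgue"
        "AE x in lebesgue. u0 x = v x" "integrable lborel (\<lambda>x. (1 + norm x) powr n * \<bar>v x\<bar>)"
        and norm: "L1_norm n u0 = ennreal (LINT x|lborel. (1 + norm x) powr n * \<bar>v x\<bar>)" by blast
      have "R u0 t x = (LINT y|lborel. remainder_kernel (nat \<lfloor>n\<rfloor>) (\<nu> * t) x y * v y)" for x
        unfolding R_def by (rule remainder_representation[OF assms(2) st v])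
      from weighted_remainder_Lp_bound[OF \<mu> p st C(1) C(2)[OF st] v(1,4) this]
      show ?thesis unfolding norm using K0 by (simp add: ennreal_mult)
    qed
    then show ?thesis using K0 by blast
  qed
  then show ?thesis by (intro exI[of _ R]) (auto simp: R_def)
qed

end
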